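(* Let $k$ be a field (of arbitrary characteristic), let $S=k[\alpha_1,\dots,\alpha_n]$ be a polynomial ring in $n$ variables over $k$, and let $P$ be its associated divided power ring, on which $S$ acts by contraction. If $n\geq 18$, then for a general $f\in P$ homogeneous of degree $3$ the apolar algebra $\mathrm{Apolar}(f)=S/\mathrm{Ann}(f)$ satisfies the small tangent space condition.
   Context: $P$ is the $k$-vector space with basis $x^{[\mathbf a]}$, $\mathbf a\in\mathbb N^n$ (the dual basis to the monomials $\alpha^{\mathbf a}$); $x^{[\mathbf a]}$ has degree $\sum a_i$. $S$ acts on $P$ by contraction: $\alpha^{\mathbf b}\cdot x^{[\mathbf a]}=x^{[\mathbf a-\mathbf b]}$ if $a_i\geq b_i$ for all $i$, and $0$ otherwise. For $f\in P$, $\mathrm{Ann}(f)=\{s\in S : s\cdot f=0\}$. For a graded $S$-module $M$ write $H(M)_i=\dim_k M_i$ ($S$ has the standard grading). "$M$ has Hilbert function $(h_0,\dots,h_j)$" means $H(M)_i=h_i$ for $0\le i\le j$ and $H(M)_i=0$ otherwise. Small tangent space condition: for $f\in P$ homogeneous of degree $3$ and $I=\mathrm{Ann}(f)$, $\mathrm{Apolar}(f)$ satisfies it if $S/I$ has Hilbert function $(1,n,n,1)$, $H(S/I^2)_4=n$ and $H(S/I^2)_5=0$. "For a general $f\in P$ homogeneous of degree $3$" means: there is an open dense subset $U$ of the affine space of cubics $\mathrm{Spec}\,\mathrm{Sym}((P_3)^\vee)$, where $P_3$ is the degree $3$ part of $P$ and $(-)^\vee=\mathrm{Hom}_k(-,k)$,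 such that the assertion holds for all rational points $f\in U(k)$. *)

theory Defs
  imports
    "HOL-Algebra.QuotRing"
    "HOL-Algebra.Ideal_Product"
    "HOL-Algebra.Embedded_Algebras"
    "HOL-Analysis.Abstract_Topology"
    "HOL-Library.Poly_Mapping"
begin

section \<open>Polynomial rings on a set of variables\<close>

text \<open>Exponent vectors are finitely supported functions \<open>'v \<Rightarrow>\<^sub>0 nat\<close>; a polynomial maps exponent
  vectors to coefficients. On both types addition is the library's, and the product of
  polynomials is convolution. The order that the library puts on \<open>'v \<Rightarrow>\<^sub>0 nat\<close> is
  lexicographic, hence not the divisibility order, and is not used here.\<close>

definition exponents :: "'v set \<Rightarrow> ('v \<Rightarrow>\<^sub>0 nat) set"
  where "exponents V = {a. Poly_Mapping.keys a \<subseteq> V}"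

definition exponent_degree :: "('v \<Rightarrow>\<^sub>0 nat) \<Rightarrow> nat"
  where "exponent_degree a = (\<Sum>v\<in>Poly_Mapping.keys a. Poly_Mapping.lookup a v)"

definition poly_ring :: "'v set \<Rightarrow> (('v \<Rightarrow>\<^sub>0 nat) \<Rightarrow>\<^sub>0 'k::field) ring"
  where "poly_ring V =
    \<lparr>carrier = {p. Poly_Mapping.keys p \<subseteq> exponents V}, mult = (*), one = 1, zero = 0, add = (+)\<rparr>"

definition const_poly :: "'k \<Rightarrow> (('v \<Rightarrow>\<^sub>0 nat) \<Rightarrow>\<^sub>0 'k::field)"
  where "const_poly c = Poly_Mapping.single 0 c"

definition homogeneous_of_degree :: "nat \<Rightarrow> (('v \<Rightarrow>\<^sub>0 nat) \<Rightarrow>\<^sub>0 'k::zero) \<Rightarrow> bool"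
  where "homogeneous_of_degree d p \<longleftrightarrow> (\<forall>a\<in>Poly_Mapping.keys p. exponent_degree a = d)"

definition poly_eval :: "('v \<Rightarrow> 'k) \<Rightarrow> (('v \<Rightarrow>\<^sub>0 nat) \<Rightarrow>\<^sub>0 'k) \<Rightarrow> 'k::field"
  where "poly_eval x p =
    (\<Sum>m\<in>Poly_Mapping.keys p. Poly_Mapping.lookup p m * (\<Prod>v\<in>Poly_Mapping.keys m. x v ^ Poly_Mapping.lookup m v))"

lemma poly_ring_is_cring:
  fixes V :: "'v set"
  shows "cring (poly_ring V :: (('v \<Rightarrow>\<^sub>0 nat) \<Rightarrow>\<^sub>0 'k::field) ring)"
proof (rule cringI)
  show "abelian_group (poly_ring V :: (('v \<Rightarrow>\<^sub>0 nat) \<Rightarrow>\<^sub>0 'k::field) ring)"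
  proof (rule abelian_groupI)
    fix x :: "('v \<Rightarrow>\<^sub>0 nat) \<Rightarrow>\<^sub>0 'k"
    assume "x \<in> carrier (poly_ring V)"
    then show "\<exists>y\<in>carrier (poly_ring V). y \<oplus>\<^bsub>poly_ring V\<^esub> x = \<zero>\<^bsub>poly_ring V\<^esub>"
      by (intro bexI[of _ "- x"]) (simp_all add: poly_ring_def)
  next
    fix x y :: "('v \<Rightarrow>\<^sub>0 nat) \<Rightarrow>\<^sub>0 'k"
    assume "x \<in> carrier (poly_ring V)" "y \<in> carrier (poly_ring V)"
    then show "x \<oplus>\<^bsub>poly_ring V\<^esub> y \<in> carrier (poly_ring V)"
      using keys_add[of x y] by (auto simp: poly_ring_def)
  qed (simp_all add: poly_ring_def add_ac)
next
  show "Group.comm_monoid (poly_ring V :: (('v \<Rightarrow>\<^sub>0 nat) \<Rightarrow>\<^sub>0 'k::field) ring)"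
  proof (rule comm_monoidI)
    fix x y :: "('v \<Rightarrow>\<^sub>0 nat) \<Rightarrow>\<^sub>0 'k"
    assume xy: "x \<in> carrier (poly_ring V)" "y \<in> carrier (poly_ring V)"
    have "a + b \<in> exponents V" if "a \<in> exponents V" "b \<in> exponents V" for a b :: "'v \<Rightarrow>\<^sub>0 nat"
      using that keys_add[of a b] by (auto simp: exponents_def)
    then show "x \<otimes>\<^bsub>poly_ring V\<^esub> y \<in> carrier (poly_ring V)"
      using xy keys_mult[of x y] by (fastforce simp: poly_ring_def)
  qed (auto simp: poly_ring_def exponents_def mult_ac)
qed (simp add: poly_ring_def distrib_right)


section \<open>Contraction and apolar algebras\<close>

text \<open>The polynomial ring \<open>S\<close> in \<open>n\<close> variables has its variables indexed by \<open>0, \<dots>, n - 1\<close>.\<close>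

abbreviation S_ring :: "nat \<Rightarrow> ((nat \<Rightarrow>\<^sub>0 nat) \<Rightarrow>\<^sub>0 'k::field) ring"
  where "S_ring n \<equiv> poly_ring {..<n}"

text \<open>The vector space \<open>P\<close>: here the basis element at an exponent vector \<open>a\<close> stands for the
  divided power monomial \<open>x\<^bsup>[a]\<^esup>\<close>, not for a monomial of \<open>S\<close>.\<close>

definition divided_powers :: "nat \<Rightarrow> ((nat \<Rightarrow>\<^sub>0 nat) \<Rightarrow>\<^sub>0 'k::field) set"
  where "divided_powers n = {f. Poly_Mapping.keys f \<subseteq> exponents {..<n}}"

definition contract_monomial :: "('v \<Rightarrow>\<^sub>0 nat) \<Rightarrow> ('v \<Rightarrow>\<^sub>0 nat) \<Rightarrow> (('v \<Rightarrow>\<^sub>0 nat) \<Rightarrow>\<^sub>0 'k::field)"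
  where "contract_monomial b a =
    (if \<forall>v. Poly_Mapping.lookup b v \<le> Poly_Mapping.lookup a v then Poly_Mapping.single (a - b) 1 else 0)"

definition contract ::
    "(('v \<Rightarrow>\<^sub>0 nat) \<Rightarrow>\<^sub>0 'k) \<Rightarrow> (('v \<Rightarrow>\<^sub>0 nat) \<Rightarrow>\<^sub>0 'k) \<Rightarrow> (('v \<Rightarrow>\<^sub>0 nat) \<Rightarrow>\<^sub>0 'k::field)"
  where "contract s f = (\<Sum>b\<in>Poly_Mapping.keys s. \<Sum>a\<in>Poly_Mapping.keys f.
    Poly_Mapping.map ((*) (Poly_Mapping.lookup s b * Poly_Mapping.lookup f a)) (contract_monomial b a))"

definition Ann :: "nat \<Rightarrow> ((nat \<Rightarrow>\<^sub>0 nat) \<Rightarrow>\<^sub>0 'k) \<Rightarrow> ((nat \<Rightarrow>\<^sub>0 nat) \<Rightarrow>\<^sub>0 'k::field) set"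
  where "Ann n f = {s \<in> carrier (S_ring n). contract s f = 0}"


section \<open>Hilbert functions of quotients of \<open>S\<close>\<close>

definition graded_piece ::
    "nat \<Rightarrow> ((nat \<Rightarrow>\<^sub>0 nat) \<Rightarrow>\<^sub>0 'k::field) set \<Rightarrow> nat \<Rightarrow> ((nat \<Rightarrow>\<^sub>0 nat) \<Rightarrow>\<^sub>0 'k) set set"
  where "graded_piece n I i =
    (\<lambda>p. I +>\<^bsub>S_ring n\<^esub> p) ` {p \<in> carrier (S_ring n). homogeneous_of_degree i p}"

text \<open>The dimension is taken over the image of the field of constants in \<open>S / I\<close>.\<close>

definition hilbert_function :: "nat \<Rightarrow> ((nat \<Rightarrow>\<^sub>0 nat) \<Rightarrow>\<^sub>0 'k::field) set \<Rightarrow> nat \<Rightarrow> nat"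
  where "hilbert_function n I i =
    ring.dim (S_ring n Quot I)
      (range (\<lambda>c. I +>\<^bsub>S_ring n\<^esub> const_poly c)) (graded_piece n I i)"

definition has_hilbert_function ::
    "nat \<Rightarrow> ((nat \<Rightarrow>\<^sub>0 nat) \<Rightarrow>\<^sub>0 'k::field) set \<Rightarrow> nat list \<Rightarrow> bool"
  where "has_hilbert_function n I h \<longleftrightarrow>
    (\<forall>i. hilbert_function n I i = (if i < length h then h ! i else 0))"

definition small_tangent_space_condition :: "nat \<Rightarrow> ((nat \<Rightarrow>\<^sub>0 nat) \<Rightarrow>\<^sub>0 'k::field) \<Rightarrow> bool"
  where "small_tangent_space_condition n f \<longleftrightarrow>
    has_hilbert_function n (Ann n f) [1, n, n, 1] \<and>
    hilbert_function n (Ann n f \<cdot>\<^bsub>S_ring n\<^esub> Ann n f) 4 = n \<and>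
    hilbert_function n (Ann n f \<cdot>\<^bsub>S_ring n\<^esub> Ann n f) 5 = 0"


section \<open>The affine space of cubics\<close>

definition Spec :: "('a, 'b) ring_scheme \<Rightarrow> 'a set set"
  where "Spec R = {p. primeideal p R}"

definition zariski :: "('a, 'b) ring_scheme \<Rightarrow> 'a set topology"
  where "zariski R = topology_generated_by {{p \<in> Spec R. g \<notin> p} | g. g \<in> carrier R}"

definition cubics :: "nat \<Rightarrow> ((nat \<Rightarrow>\<^sub>0 nat) \<Rightarrow>\<^sub>0 'k::field) set"
  where "cubics n = {f \<in> divided_powers n. homogeneous_of_degree 3 f}"

text \<open>\<open>Sym((P\<^sub>3)\<^sup>\<or>)\<close> is the polynomial ring on the basis of \<open>(P\<^sub>3)\<^sup>\<or>\<close> dual to the \<open>x\<^bsup>[a]\<^esup>\<close> of degree 3,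
  so its variables are indexed by the exponent vectors of degree 3. A cubic \<open>f\<close> is a rational point
  of the spectrum, namely the kernel of the homomorphism to \<open>k\<close> that sends the
  variable at \<open>a\<close> to the coefficient of \<open>x\<^bsup>[a]\<^esup>\<close> in \<open>f\<close>.\<close>

abbreviation cubics_coordinate_ring :: "nat \<Rightarrow> (((nat \<Rightarrow>\<^sub>0 nat) \<Rightarrow>\<^sub>0 nat) \<Rightarrow>\<^sub>0 'k::field) ring"
  where "cubics_coordinate_ring n \<equiv> poly_ring {a \<in> exponents {..<n}. exponent_degree a = 3}"

definition rational_point ::
    "nat \<Rightarrow> ((nat \<Rightarrow>\<^sub>0 nat) \<Rightarrow>\<^sub>0 'k) \<Rightarrow> (((nat \<Rightarrow>\<^sub>0 nat) \<Rightarrow>\<^sub>0 nat) \<Rightarrow>\<^sub>0 'k::field) set"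
  where "rational_point n f = {g \<in> carrier (cubics_coordinate_ring n). poly_eval (Poly_Mapping.lookup f) g = 0}"

definition for_general_cubic :: "nat \<Rightarrow> (((nat \<Rightarrow>\<^sub>0 nat) \<Rightarrow>\<^sub>0 'k::field) \<Rightarrow> bool) \<Rightarrow> bool"
  where "for_general_cubic n Q \<longleftrightarrow>
    (\<exists>U :: (((nat \<Rightarrow>\<^sub>0 nat) \<Rightarrow>\<^sub>0 nat) \<Rightarrow>\<^sub>0 'k) set set.
       openin (zariski (cubics_coordinate_ring n)) U \<and>
       zariski (cubics_coordinate_ring n) closure_of U = topspace (zariski (cubics_coordinate_ring n)) \<and>
       (\<forall>f\<in>cubics n. rational_point n f \<in> U \<longrightarrow> Q f))"

end

theory Submission
  imports Defs
begin

text \<open>The condition is open, so one cubic that satisfies it in every characteristic is enough. Take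
  \<open>f\<^sub>0 = \<Sum>\<^sub>t x\<^sub>t x\<^sub>t\<^sub>+\<^sub>1 x\<^sub>t\<^sub>+\<^sub>2\<close> with indices modulo \<open>n\<close>. In degree 2 its annihilator is spanned by
  the products of two equal or non-neighbouring variables (neighbours are at distance 1 or 2) and by
  \<open>\<alpha>\<^sub>i \<alpha>\<^sub>i\<^sub>+\<^sub>1 - \<alpha>\<^sub>i\<^sub>-\<^sub>2 \<alpha>\<^sub>i - \<alpha>\<^sub>i\<^sub>+\<^sub>1 \<alpha>\<^sub>i\<^sub>+\<^sub>3\<close>. Modulo products of two such quadrics, every quartic
  monomial is a combination of the \<open>n\<close> classes \<open>\<alpha>\<^sub>i \<alpha>\<^sub>j\<^sub>-\<^sub>1 \<alpha>\<^sub>j \<alpha>\<^sub>j\<^sub>+\<^sub>1\<close> with \<open>j\<close> far from \<open>i\<close>, which do not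
  depend on \<open>j\<close>; multiplied by any variable these classes vanish.

  The other bound in degree 4 holds because \<open>s \<mapsto> (\<partial>s/\<partial>\<alpha>\<^sub>i) \<cdot> f\<close>, evaluated in degree 0, vanishes on
  \<open>Ann(f)\<^sup>2\<close> by the Leibniz rule, and for \<open>f = f\<^sub>0\<close> these functionals are dual to the \<open>n\<close> classes.

  All quadrics used deform with \<open>f\<close>: their coefficients are polynomials in those of \<open>f\<close> after
  clearing one denominator. So spanning and duality persist on a principal open set that
  contains \<open>f\<^sub>0\<close>, and it is dense because the coordinate ring is a domain.\<close>

text \<open>The trinomials have a simple origin. Only the edge with middle j contains the variables
  j-1 and j+1, so contracting \<open>f\<^sub>0\<close> with their product leaves
  \<open>x\<^sub>j\<close>; contracting with the variables i and i+1 leaves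
  \<open>x\<^sub>i\<^sub>-\<^sub>1 + x\<^sub>i\<^sub>+\<^sub>2\<close>, which two such products
  cancel.

  Other cubics need not have annihilating quadrics of this sparse form, so monomials are manipulated
  at \<open>f\<^sub>0\<close> alone. There each reduction expands one product of two quadrics,
  chosen so that all but the wanted monomials split into two distant pairs or are known already.
  What is carried to other \<open>f\<close> is linear algebra: a matrix with polynomial entries
  whose rows span at \<open>f\<^sub>0\<close> has an inverse on one side up to a polynomial factor
  that is nonzero at \<open>f\<^sub>0\<close>. Upper and lower bounds are separate statements of
  this kind.

  The quadrics used at \<open>f\<^sub>0\<close> have coefficients 1 and -1, and the monomials that
  represent the classes are squarefree, so that differentiating them loses nothing in positive
  characteristic.\<close>

abbreviation lookup :: "('a \<Rightarrow>\<^sub>0 'b) \<Rightarrow> 'a \<Rightarrow> 'b::zero"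
  where "lookup \<equiv> Poly_Mapping.lookup"

abbreviation keys :: "('a \<Rightarrow>\<^sub>0 'b::zero) \<Rightarrow> 'a set"
  where "keys \<equiv> Poly_Mapping.keys"

abbreviation mon :: "('v \<Rightarrow>\<^sub>0 nat) \<Rightarrow> (('v \<Rightarrow>\<^sub>0 nat) \<Rightarrow>\<^sub>0 'k::field)"
  where "mon a \<equiv> Poly_Mapping.single a 1"

section \<open>Linear functions of a polynomial\<close>

lemma sum_keys_superset:
  fixes p :: "'a \<Rightarrow>\<^sub>0 'b::zero" and G :: "'a \<Rightarrow> 'b \<Rightarrow> 'c::comm_monoid_add"
  assumes "finite A" "keys p \<subseteq> A" "\<And>a. G a 0 = 0"
  shows "(\<Sum>a\<in>keys p. G a (lookup p a)) = (\<Sum>a\<in>A. G a (lookup p a))"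
  using assms by (intro sum.mono_neutral_left) (auto simp: in_keys_iff)

text \<open>Cancellation can make the support of \<open>p + q\<close> smaller than the union of the
  two supports, so all three sums are taken over that union. Additivity of \<open>poly_eval\<close>,
  \<open>exponent_degree\<close>, \<open>pairing\<close> and \<open>partial_deriv\<close> follows as
  an instance.\<close>

lemma sum_keys_add:
  fixes p q :: "'a \<Rightarrow>\<^sub>0 'b::comm_monoid_add" and G :: "'a \<Rightarrow> 'b \<Rightarrow> 'c::comm_monoid_add"
  assumes "\<And>a. G a 0 = 0" "\<And>a x y. G a (x + y) = G a x + G a y"
  shows "(\<Sum>a\<in>keys (p + q). G a (lookup (p + q) a))
    = (\<Sum>a\<in>keys p. G a (lookup p a)) + (\<Sum>a\<in>keys q. G a (lookup q a))"
proof -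
  let ?A = "keys p \<union> keys q"
  have "(\<Sum>a\<in>keys r. G a (lookup r a)) = (\<Sum>a\<in>?A. G a (lookup r a))"
    if "keys r \<subseteq> ?A" for r
    using that assms by (intro sum_keys_superset) auto
  from this[of p] this[of q] this[of "p + q"] show ?thesis
    using keys_add[of p q] by (simp add: lookup_add assms(2) sum.distrib)
qed

text \<open>The summands in \<open>add\<close> may overlap in support, so for additive properties
  that step is trivial, and two nested inductions reduce a bilinear identity to monomials.\<close>

lemma poly_additive_induct [case_names single add]:
  fixes p :: "'a \<Rightarrow>\<^sub>0 'b::comm_monoid_add"
  assumes "\<And>a c. P (Poly_Mapping.single a c)" "\<And>p q. P p \<Longrightarrow> P q \<Longrightarrow> P (p + q)"
  shows "P p"
proof -
  have sum: "P (\<Sum>a\<in>A. Poly_Mapping.single a (lookup p a))" if "finite A" for A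
    using that
  proof induction
    case empty
    then show ?case using assms(1)[of undefined 0] by simp
  next
    case (insert a A)
    then show ?case using assms by simp
  qed
  have "p = (\<Sum>a\<in>keys p. Poly_Mapping.single a (lookup p a))"
  proof (rule poly_mapping_eqI)
    fix b
    show "lookup p b = lookup (\<Sum>a\<in>keys p. Poly_Mapping.single a (lookup p a)) b"
      by (cases "b \<in> keys p")
        (simp_all add: lookup_sum lookup_single when_def in_keys_iff sum.delta)
  qed
  with sum[of "keys p"] show ?thesis by simp
qed

lemma const_mult_mon: "Poly_Mapping.single a c = const_poly c * mon a"
  by (simp add: const_poly_def mult_single)

lemma const_poly_simps [simp]:
  "const_poly 0 = 0" "const_poly 1 = 1"
  "const_poly (c + d) = const_poly c + const_poly d"
  "const_poly (c - d) = const_poly c - const_poly d"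
  "const_poly (c * d) = const_poly c * const_poly d"
  "const_poly (- c) = - const_poly c"
  by (simp_all add: const_poly_def single_add single_diff mult_single single_uminus)

lemma lookup_const_mult: "lookup (const_poly c * p) a = c * lookup p a"
proof -
  have "const_poly c * p = Poly_Mapping.map ((*) c) p"
    by (simp add: const_poly_def mult_map_scale_conv_mult)
  then show ?thesis by (simp add: map.rep_eq when_def)
qed

lemma poly_eval_add: "poly_eval x (p + q) = poly_eval x p + poly_eval x q"
  unfolding poly_eval_def by (rule sum_keys_add) (simp_all add: distrib_right)

lemma poly_eval_single:
  "poly_eval x (Poly_Mapping.single m c) = c * (\<Prod>v\<in>keys m. x v ^ lookup m v)"
  by (simp add: poly_eval_def)

lemma prod_power_lookup_add:
  fixes x :: "'v \<Rightarrow> 'k::field"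
  shows "(\<Prod>v\<in>keys (a + b). x v ^ lookup (a + b) v)
    = (\<Prod>v\<in>keys a. x v ^ lookup a v) * (\<Prod>v\<in>keys b. x v ^ lookup b v)"
proof -
  have "(\<Prod>v\<in>keys c. x v ^ lookup c v) = (\<Prod>v\<in>keys a \<union> keys b. x v ^ lookup c v)"
    if "keys c \<subseteq> keys a \<union> keys b" for c
    using that by (intro prod.mono_neutral_left) (auto simp: in_keys_iff)
  from this[of a] this[of b] this[of "a + b"] show ?thesis
    using keys_add[of a b] by (simp add: lookup_add power_add prod.distrib)
qed

lemma poly_eval_mult: "poly_eval x (p * q) = poly_eval x p * poly_eval x q"
proof (induction p rule: poly_additive_induct)
  case (single a c)
  show ?case
  proof (induction q rule: poly_additive_induct)
    case (single b d)
    show ?case by (simp add: mult_single poly_eval_single prod_power_lookup_add)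
  qed (simp add: poly_eval_add distrib_left)
qed (simp add: poly_eval_add distrib_right)

section \<open>Regular functions and general cubics\<close>

text \<open>Polynomials in the coefficients of \<open>f\<close> are seen through their values and
  combined pointwise. Over a finite field several polynomials can have the same values, but a
  nonzero value still certifies that any representing polynomial is nonzero.\<close>

definition regular_fun :: "nat \<Rightarrow> (((nat \<Rightarrow>\<^sub>0 nat) \<Rightarrow>\<^sub>0 'k) \<Rightarrow> 'k::field) \<Rightarrow> bool"
  where "regular_fun n h \<longleftrightarrow>
    (\<exists>g\<in>carrier (cubics_coordinate_ring n). \<forall>f. h f = poly_eval (lookup f) g)"

lemma regular_fun_const: "regular_fun n (\<lambda>_. c)"
  unfolding regular_fun_def
  by (intro bexI[of _ "const_poly c"])
    (auto simp: const_poly_def poly_eval_single poly_ring_def exponents_def)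

lemma regular_fun_lookup:
  assumes "a \<in> exponents {..<n}" "exponent_degree a = 3"
  shows "regular_fun n (\<lambda>f. lookup f a)"
  unfolding regular_fun_def
  using assms by (intro bexI[of _ "mon (Poly_Mapping.single a 1)"])
    (auto simp: poly_eval_single poly_ring_def exponents_def)

lemma regular_fun_add:
  assumes "regular_fun n g" "regular_fun n h"
  shows "regular_fun n (\<lambda>f. g f + h f)"
proof -
  let ?R = "cubics_coordinate_ring n :: (((nat \<Rightarrow>\<^sub>0 nat) \<Rightarrow>\<^sub>0 nat) \<Rightarrow>\<^sub>0 'a) ring"
  interpret cring ?R by (rule poly_ring_is_cring)
  obtain G H where "G \<in> carrier ?R" "H \<in> carrier ?R"
    and "\<forall>f. g f = poly_eval (lookup f) G" "\<forall>f. h f = poly_eval (lookup f) H"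
    using assms unfolding regular_fun_def by blast
  then show ?thesis unfolding regular_fun_def
    using a_closed[of G H] by (intro bexI[of _ "G + H"]) (auto simp: poly_eval_add poly_ring_def)
qed

lemma regular_fun_mult:
  assumes "regular_fun n g" "regular_fun n h"
  shows "regular_fun n (\<lambda>f. g f * h f)"
proof -
  let ?R = "cubics_coordinate_ring n :: (((nat \<Rightarrow>\<^sub>0 nat) \<Rightarrow>\<^sub>0 nat) \<Rightarrow>\<^sub>0 'a) ring"
  interpret cring ?R by (rule poly_ring_is_cring)
  obtain G H where "G \<in> carrier ?R" "H \<in> carrier ?R"
    and "\<forall>f. g f = poly_eval (lookup f) G" "\<forall>f. h f = poly_eval (lookup f) H"
    using assms unfolding regular_fun_def by blast
  then show ?thesis unfolding regular_fun_def
    using m_closed[of G H] by (intro bexI[of _ "G * H"]) (auto simp: poly_eval_mult poly_ring_def)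
qed

lemma regular_fun_uminus:
  assumes "regular_fun n h"
  shows "regular_fun n (\<lambda>f. - h f)"
  using regular_fun_mult[OF regular_fun_const[of n "-1"] assms] by simp

lemma regular_fun_diff:
  assumes "regular_fun n g" "regular_fun n h"
  shows "regular_fun n (\<lambda>f. g f - h f)"
  using regular_fun_add[OF assms(1) regular_fun_uminus[OF assms(2)]] by simp

lemma regular_fun_sum:
  assumes "\<And>x. x \<in> A \<Longrightarrow> regular_fun n (h x)"
  shows "regular_fun n (\<lambda>f. \<Sum>x\<in>A. h x f)"
  using assms
  by (induction A rule: infinite_finite_induct) (simp_all add: regular_fun_const regular_fun_add)

lemmas regular_fun_intros = regular_fun_const regular_fun_add regular_fun_mult regular_fun_diff
  regular_fun_uminus regular_fun_sum

text \<open>The zero ideal is prime and, as the generic point, lies in every nonempty open set; so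
  the principal open set of \<open>G\<close> is dense once \<open>G\<close> is nonzero. The value at
  \<open>f\<^sub>0\<close> certifies this also over a finite field, where the rational points
  themselves need not be dense.\<close>

lemma for_general_cubicI:
  fixes g :: "((nat \<Rightarrow>\<^sub>0 nat) \<Rightarrow>\<^sub>0 'k::field) \<Rightarrow> 'k"
  assumes "regular_fun n g" "g f\<^sub>0 \<noteq> 0"
    and Q: "\<And>f. f \<in> cubics n \<Longrightarrow> g f \<noteq> 0 \<Longrightarrow> Q f"
  shows "for_general_cubic n Q"
proof -
  define R where "R = (cubics_coordinate_ring n :: (((nat \<Rightarrow>\<^sub>0 nat) \<Rightarrow>\<^sub>0 nat) \<Rightarrow>\<^sub>0 'k) ring)"
  interpret cring R unfolding R_def by (rule poly_ring_is_cring)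
  obtain G where G: "G \<in> carrier R" "\<And>f. g f = poly_eval (lookup f) G"
    using assms(1) unfolding regular_fun_def R_def by blast
  have G0: "G \<noteq> 0" using G(2)[of f\<^sub>0] assms(2) by (auto simp: poly_eval_def)
  have prime0: "{0} \<in> Spec R"
  proof -
    have "primeideal {\<zero>\<^bsub>R\<^esub>} R"
    proof (rule primeidealI)
      show "ideal {\<zero>\<^bsub>R\<^esub>} R" by (rule zeroideal)
      show "cring R" ..
      have "\<one>\<^bsub>R\<^esub> \<noteq> \<zero>\<^bsub>R\<^esub>" by (simp add: R_def poly_ring_def)
      then show "carrier R \<noteq> {\<zero>\<^bsub>R\<^esub>}" using one_closed by fastforce
    qed (auto simp: R_def poly_ring_def)
    then show ?thesis by (simp add: Spec_def R_def poly_ring_def)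
  qed
  define U where "U = {p \<in> Spec R. G \<notin> p}"
  \<comment> \<open>Being empty or containing \<open>{0}\<close> passes to finite intersections and
    arbitrary unions, so only the basic open sets need an argument.\<close>
  have generic: "{0} \<in> T" if "openin (zariski R) T" "T \<noteq> {}" for T
  proof -
    have "generate_topology_on {{p \<in> Spec R. g \<notin> p} | g. g \<in> carrier R} T"
      using that(1) by (simp add: zariski_def openin_topology_generated_by_iff)
    then have "T = {} \<or> {0} \<in> T"
    proof induction
      case (Basis s)
      then obtain h where h: "h \<in> carrier R" "s = {p \<in> Spec R. h \<notin> p}" by blast
      show ?case
      proof (cases "h = 0")
        case True
        have "0 \<in> p" if "p \<in> Spec R" for p
        proof -
          from that interpret primeideal p R by (simp add: Spec_def)
          show ?thesis using additive_subgroup.zero_closed[OF is_additive_subgroup]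
            by (simp add: R_def poly_ring_def)
        qed
        then show ?thesis using True h by auto
      next
        case False
        then show ?thesis using prime0 h by auto
      qed
    qed auto
    with that(2) show ?thesis by blast
  qed
  have "openin (zariski R) U"
    unfolding zariski_def openin_topology_generated_by_iff U_def
    using G(1) by (intro generate_topology_on.Basis) blast
  moreover have "zariski R closure_of U = topspace (zariski R)"
  proof -
    have "{0} \<in> U" using prime0 G0 by (simp add: U_def)
    then show ?thesis using generic by (fastforce simp: in_closure_of)
  qed
  moreover have "Q f" if "f \<in> cubics n" "rational_point n f \<in> U" for f
  proof (rule Q[OF that(1)])
    show "g f \<noteq> 0"
      using that(2) G by (simp add: U_def rational_point_def R_def)
  qed
  ultimately show ?thesis unfolding for_general_cubic_def R_def by blast
qed

section \<open>Openness of the spanning condition\<close>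

text \<open>Fraction-free Gaussian elimination; \<open>g\<close> is built from pivots that do not vanish at \<open>f\<^sub>0\<close>.\<close>

lemma regular_elimination:
  fixes v :: "'j \<Rightarrow> 'x \<Rightarrow> ((nat \<Rightarrow>\<^sub>0 nat) \<Rightarrow>\<^sub>0 'k::field) \<Rightarrow> 'k"
  assumes "finite X" and "finite J"
    and "\<And>j x. j \<in> J \<Longrightarrow> x \<in> X \<Longrightarrow> regular_fun n (v j x)"
    and "\<And>x. x \<in> X \<Longrightarrow>
      \<exists>c. \<forall>y\<in>X. (\<Sum>j\<in>J. c j * v j y f\<^sub>0) = (if x = y then 1 else 0)"
  shows "\<exists>g. regular_fun n g \<and> g f\<^sub>0 \<noteq> 0 \<and> (\<forall>x\<in>X. \<exists>c. (\<forall>j\<in>J. regular_fun n (c j)) \<and>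
    (\<forall>f. \<forall>y\<in>X. (\<Sum>j\<in>J. c j f * v j y f) = (if x = y then g f else 0)))"
  using assms(1,3,4)
proof (induction X arbitrary: v rule: finite_induct)
  case empty
  show ?case by (intro exI[of _ "\<lambda>_. 1"]) (simp add: regular_fun_const)
next
  case (insert x X)
  obtain j\<^sub>0 where j0: "j\<^sub>0 \<in> J" "v j\<^sub>0 x f\<^sub>0 \<noteq> 0"
  proof -
    obtain c where "(\<Sum>j\<in>J. c j * v j x f\<^sub>0) = 1" using insert.prems(2)[of x] by auto
    then have "(\<Sum>j\<in>J. c j * v j x f\<^sub>0) \<noteq> 0" by simp
    then obtain j where "j \<in> J" "c j * v j x f\<^sub>0 \<noteq> 0" by (rule sum.not_neutral_contains_not_neutral)
    then show thesis using that by auto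
  qed
  define p where "p = v j\<^sub>0 x"
  \<comment> \<open>Row \<open>j\<close> is cleared in column \<open>x\<close> by the pivot row
    \<open>j\<^sub>0\<close>, multiplying by the pivot instead of dividing.\<close>
  define w where "w j y f = p f * v j y f - v j x f * v j\<^sub>0 y f" for j y f
  have p: "regular_fun n p" using insert.prems(1) j0 by (simp add: p_def)
  have "regular_fun n (w j y)" if "j \<in> J" "y \<in> X" for j y
    unfolding w_def using that j0 p insert.prems(1)
    by (intro regular_fun_diff regular_fun_mult) auto
  moreover have "\<exists>c. \<forall>z\<in>X. (\<Sum>j\<in>J. c j * w j z f\<^sub>0) = (if y = z then 1 else 0)" if y: "y \<in> X" for y
  proof -
    obtain c where c: "\<forall>z\<in>insert x X. (\<Sum>j\<in>J. c j * v j z f\<^sub>0) = (if y = z then 1 else 0)"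
      using insert.prems(2)[OF insertI2[OF y]] by (rule exE)
    have "x \<noteq> y" using y insert.hyps by blast
    \<comment> \<open>The combination given by \<open>c\<close> vanishes in column \<open>x\<close>,
      so the multiple of the pivot row that it makes \<open>w\<close> subtract vanishes too.
      Division is harmless since only values at \<open>f\<^sub>0\<close> occur.\<close>
    have "c j / p f\<^sub>0 * w j z f\<^sub>0 = c j * v j z f\<^sub>0 - c j * v j x f\<^sub>0 * v j\<^sub>0 z f\<^sub>0 / p f\<^sub>0" for j z
      using j0(2) by (simp add: w_def p_def field_simps)
    then have "(\<Sum>j\<in>J. c j / p f\<^sub>0 * w j z f\<^sub>0)
        = (\<Sum>j\<in>J. c j * v j z f\<^sub>0) - (\<Sum>j\<in>J. c j * v j x f\<^sub>0) * v j\<^sub>0 z f\<^sub>0 / p f\<^sub>0" for z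
      by (simp add: sum_subtractf sum_distrib_right sum_divide_distrib)
    with c \<open>x \<noteq> y\<close> show ?thesis by (intro exI[of _ "\<lambda>j. c j / p f\<^sub>0"]) auto
  qed
  ultimately obtain g where g: "regular_fun n g" "g f\<^sub>0 \<noteq> 0"
    and "\<forall>y\<in>X. \<exists>c. (\<forall>j\<in>J. regular_fun n (c j)) \<and>
      (\<forall>f. \<forall>z\<in>X. (\<Sum>j\<in>J. c j f * w j z f) = (if y = z then g f else 0))"
    using insert.IH[of w] by blast
  then obtain c where c: "\<And>y j. y \<in> X \<Longrightarrow> j \<in> J \<Longrightarrow> regular_fun n (c y j)"
    and cw: "\<And>y f z. y \<in> X \<Longrightarrow> z \<in> X \<Longrightarrow>
      (\<Sum>j\<in>J. c y j f * w j z f) = (if y = z then g f else 0)"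
    by metis
  \<comment> \<open>The combination of rows of \<open>w\<close> rewritten in rows of
    \<open>v\<close>: row \<open>j\<^sub>0\<close> takes up everything that \<open>w\<close>
    subtracted.\<close>
  define e where "e y j f = c y j f * p f - (if j = j\<^sub>0 then \<Sum>i\<in>J. c y i f * v i x f else 0)" for y j f
  have e: "regular_fun n (e y j)" if "y \<in> X" "j \<in> J" for y j
  proof (cases "j = j\<^sub>0")
    case True
    show ?thesis unfolding e_def using that c p insert.prems(1) True
      by (auto intro!: regular_fun_intros)
  next
    case False
    show ?thesis unfolding e_def using that c p False by (auto intro!: regular_fun_intros)
  qed
  have ev: "(\<Sum>j\<in>J. e y j f * v j z f) = (\<Sum>j\<in>J. c y j f * w j z f)" for y z f
  proof -
    have "(\<Sum>j\<in>J. (if j = j\<^sub>0 then \<Sum>i\<in>J. c y i f * v i x f else 0) * v j z f)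
        = (\<Sum>j\<in>J. if j = j\<^sub>0 then (\<Sum>i\<in>J. c y i f * v i x f) * v j z f else 0)"
      by (intro sum.cong) auto
    also have "\<dots> = (\<Sum>i\<in>J. c y i f * v i x f) * v j\<^sub>0 z f"
      using assms(2) j0(1) by simp
    finally show ?thesis unfolding e_def w_def
      by (simp add: left_diff_distrib right_diff_distrib sum_subtractf sum_distrib_left sum_distrib_right mult_ac)
  qed
  have ev_eq: "(\<Sum>j\<in>J. e y j f * v j z f) = (if y = z then g f else 0)"
    if "y \<in> X" "z \<in> insert x X" for y z f
  proof (cases "z = x")
    case True
    then have "w j z f = 0" for j by (simp add: w_def p_def)
    then show ?thesis using ev[of y f z] that True insert.hyps by auto
  next
    case False
    then show ?thesis using ev[of y f z] cw[of y z f] that by simp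
  qed
  \<comment> \<open>Back substitution: from \<open>g\<close> times the pivot row its entries in the
    columns \<open>X\<close> are removed, which leaves only \<open>p f * g f\<close> in column
    \<open>x\<close>.\<close>
  define e' where "e' j f = (if j = j\<^sub>0 then g f else 0) - (\<Sum>y\<in>X. v j\<^sub>0 y f * e y j f)" for j f
  have e': "regular_fun n (e' j)" if "j \<in> J" for j
  proof (cases "j = j\<^sub>0")
    case True
    show ?thesis unfolding e'_def using that e g insert.prems(1) j0 True
      by (auto intro!: regular_fun_intros)
  next
    case False
    show ?thesis unfolding e'_def using that e insert.prems(1) j0 False
      by (auto intro!: regular_fun_intros)
  qed
  have e'v: "(\<Sum>j\<in>J. e' j f * v j z f) = (if x = z then p f * g f else 0)"
    if "z \<in> insert x X" for z f
  proof -
    have "(\<Sum>j\<in>J. (if j = j\<^sub>0 then g f else 0) * v j z f)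
        = (\<Sum>j\<in>J. if j = j\<^sub>0 then g f * v j z f else 0)"
      by (intro sum.cong) auto
    also have "\<dots> = g f * v j\<^sub>0 z f" using assms(2) j0(1) by simp
    finally have "(\<Sum>j\<in>J. e' j f * v j z f)
        = g f * v j\<^sub>0 z f - (\<Sum>j\<in>J. \<Sum>y\<in>X. v j\<^sub>0 y f * (e y j f * v j z f))"
      unfolding e'_def
      by (simp add: left_diff_distrib right_diff_distrib sum_subtractf
          sum_distrib_left sum_distrib_right mult_ac)
    also have "(\<Sum>j\<in>J. \<Sum>y\<in>X. v j\<^sub>0 y f * (e y j f * v j z f))
        = (\<Sum>y\<in>X. v j\<^sub>0 y f * (\<Sum>j\<in>J. e y j f * v j z f))"
      by (subst sum.swap) (simp add: sum_distrib_left)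
    also have "\<dots> = (\<Sum>y\<in>X. v j\<^sub>0 y f * (if y = z then g f else 0))"
      using that by (intro sum.cong) (simp_all add: ev_eq)
    also have "\<dots> = (\<Sum>y\<in>X. if y = z then v j\<^sub>0 y f * g f else 0)"
      by (intro sum.cong) auto
    also have "\<dots> = (if z \<in> X then v j\<^sub>0 z f * g f else 0)"
      using insert.hyps by simp
    finally show ?thesis using that insert.hyps by (auto simp: p_def)
  qed
  show ?case
  proof (intro exI[of _ "\<lambda>f. p f * g f"] conjI ballI)
    show "regular_fun n (\<lambda>f. p f * g f)" using p g by (intro regular_fun_mult)
    show "p f\<^sub>0 * g f\<^sub>0 \<noteq> 0" using g j0 by (simp add: p_def)
    fix y assume y: "y \<in> insert x X"
    show "\<exists>c. (\<forall>j\<in>J. regular_fun n (c j)) \<and> (\<forall>f. \<forall>z\<in>insert x X.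
      (\<Sum>j\<in>J. c j f * v j z f) = (if y = z then p f * g f else 0))"
    proof (cases "y = x")
      case True
      then show ?thesis using e' e'v by (intro exI[of _ e']) simp
    next
      case False
      then have "y \<in> X" using y by blast
      have "(\<Sum>j\<in>J. p f * e y j f * v j z f) = (if y = z then p f * g f else 0)"
        if "z \<in> insert x X" for f z
        using ev_eq[OF \<open>y \<in> X\<close> that, of f] by (simp add: mult.assoc flip: sum_distrib_left)
      then show ?thesis using e[OF \<open>y \<in> X\<close>] p
        by (intro exI[of _ "\<lambda>j f. p f * e y j f"]) (auto intro!: regular_fun_mult)
    qed
  qed
qed

section \<open>Quartic products in a cyclic arrangement of variables\<close>

text \<open>\<open>Q\<close> models the annihilating quadrics of the cyclic cubic and
  \<open>W\<close> the span of their products. An arbitrary commutative ring keeps the identities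
  free of exponent vectors and makes the reversed arrangement another instance.\<close>

locale cyclic_quadrics =
  fixes n :: int and X :: "int \<Rightarrow> 'a::comm_ring_1" and Q W :: "'a set"
  assumes n_ge: "n \<ge> 18"
    and X_periodic: "X (i + n) = X i"
    and square_in_Q: "X i * X i \<in> Q"
    and far_in_Q: "3 \<le> d \<Longrightarrow> d \<le> n - 3 \<Longrightarrow> X i * X (i + d) \<in> Q"
    and adjacent_in_Q: "X i * X (i + 1) - X (i - 2) * X i - X (i + 1) * X (i + 3) \<in> Q"
    and prod_in_W: "p \<in> Q \<Longrightarrow> q \<in> Q \<Longrightarrow> p * q \<in> W"
    and W_diff: "p \<in> W \<Longrightarrow> q \<in> W \<Longrightarrow> p - q \<in> W"
begin

lemma W_zero: "0 \<in> W"
proof -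
  have "X 0 * X 0 * (X 0 * X 0) \<in> W" by (intro prod_in_W square_in_Q)
  from W_diff[OF this this] show ?thesis by simp
qed

lemma W_add: "p \<in> W \<Longrightarrow> q \<in> W \<Longrightarrow> p + q \<in> W"
  using W_diff[of p "0 - q"] W_diff[OF W_zero] by simp

lemma far: "i = j \<or> (3 \<le> j - i \<and> j - i \<le> n - 3) \<or> (3 \<le> i - j \<and> i - j \<le> n - 3) \<Longrightarrow> X i * X j \<in> Q"
  using square_in_Q[of i] far_in_Q[of "j - i" i] far_in_Q[of "i - j" j] by (auto simp: mult.commute)

lemma adjacent:
  "j = i + 1 \<Longrightarrow> k = i - 2 \<Longrightarrow> l = i + 3 \<Longrightarrow> X i * X j - X k * X i - X j * X l \<in> Q"
  using adjacent_in_Q by simp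

text \<open>The adjacent quadric of \<open>i\<close> is symmetric about the midpoint of
  \<open>i\<close> and \<open>i + 1\<close>, so reversal sends it to the one of
  \<open>-1 - i\<close>. Each identity below thereby yields a second one.\<close>

lemma mirror: "cyclic_quadrics n (\<lambda>i. X (- i)) Q W"
proof
  fix i d :: int
  show "X (- (i + n)) = X (- i)" using X_periodic[of "- i - n"] by simp
  show "3 \<le> d \<Longrightarrow> d \<le> n - 3 \<Longrightarrow> X (- i) * X (- (i + d)) \<in> Q" by (rule far) simp
  show "X (- i) * X (- (i + 1)) - X (- (i - 2)) * X (- i) - X (- (i + 1)) * X (- (i + 3)) \<in> Q"
    using adjacent_in_Q[of "-1 - i"] by (simp add: algebra_simps)
qed (use n_ge square_in_Q prod_in_W W_diff in auto)

section \<open>Quartic monomials that lie in \<open>W\<close>\<close>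

text \<open>The digits in a name are the offsets of the four indices from \<open>i\<close>.\<close>

lemma quartic_0233: "X i * X (i + 2) * X (i + 3) * X (i + 3) \<in> W"
proof -
  \<comment> \<open>Expands the square of \<open>X (i + 3)\<close> times the adjacent quadric of
    \<open>i - 1\<close>, which has \<open>X i * X (i + 2)\<close> as its last term. The other two
    terms split into distant pairs.\<close>
  have "X i * X (i + 2) * X (i + 3) * X (i + 3) = (X (i - 1) * X (i + 3)) * (X i * X (i + 3))
      - (X (i - 3) * X (i + 3)) * (X (i - 1) * X (i + 3))
      - (X (i + 3) * X (i + 3)) * (X (i - 1) * X i - X (i - 3) * X (i - 1) - X i * X (i + 2))"
    by (simp add: algebra_simps)
  also have "\<dots> \<in> W" by (intro W_diff W_add prod_in_W far adjacent; use n_ge in simp)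
  finally show ?thesis .
qed

text \<open>\<open>X i * X (i + 3)\<close> times the adjacent quadric of \<open>i + 2\<close> trades
  \<open>quartic_0233\<close> for this monomial; the third term splits into a square and a distant
  pair.\<close>

lemma quartic_0023: "X i * X i * X (i + 2) * X (i + 3) \<in> W"
proof -
  have "X i * X i * X (i + 2) * X (i + 3) = X i * X (i + 2) * X (i + 3) * X (i + 3)
      - (X (i + 3) * X (i + 3)) * (X i * X (i + 5))
      - (X i * X (i + 3)) * (X (i + 2) * X (i + 3) - X i * X (i + 2) - X (i + 3) * X (i + 5))"
    by (simp add: algebra_simps)
  also have "\<dots> \<in> W" by (intro W_diff quartic_0233 prod_in_W far adjacent; use n_ge in simp)
  finally show ?thesis .
qed

lemma quartic_0133: "X i * X (i + 1) * X (i + 3) * X (i + 3) \<in> W"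
  using cyclic_quadrics.quartic_0023[OF mirror, of "- i - 3"] by (simp add: ac_simps)
lemma quartic_0013: "X i * X i * X (i + 1) * X (i + 3) \<in> W"
  using cyclic_quadrics.quartic_0233[OF mirror, of "- i - 3"] by (simp add: ac_simps)

text \<open>The same adjacent quadric, now times \<open>X i * X i\<close>, leads back to
  \<open>quartic_0023\<close>.\<close>

lemma quartic_0002: "X i * X i * X i * X (i + 2) \<in> W"
proof -
  have "X i * X i * X i * X (i + 2) = X i * X i * X (i + 2) * X (i + 3)
      - (X i * X (i + 3)) * (X i * X (i + 5))
      - (X i * X i) * (X (i + 2) * X (i + 3) - X i * X (i + 2) - X (i + 3) * X (i + 5))"
    by (simp add: algebra_simps)
  also have "\<dots> \<in> W" by (intro W_diff quartic_0023 prod_in_W far adjacent; use n_ge in simp)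
  finally show ?thesis .
qed

lemma quartic_0222: "X i * X (i + 2) * X (i + 2) * X (i + 2) \<in> W"
  using cyclic_quadrics.quartic_0002[OF mirror, of "- i - 2"] by (simp add: ac_simps)

lemma quartic_0244: "X i * X (i + 2) * X (i + 4) * X (i + 4) \<in> W"
proof -
  have "X i * X (i + 2) * X (i + 4) * X (i + 4) = (X (i - 1) * X (i + 4)) * (X i * X (i + 4))
      - (X (i - 3) * X (i + 4)) * (X (i - 1) * X (i + 4))
      - (X (i + 4) * X (i + 4)) * (X (i - 1) * X i - X (i - 3) * X (i - 1) - X i * X (i + 2))"
    by (simp add: algebra_simps)
  also have "\<dots> \<in> W" by (intro W_diff prod_in_W far adjacent; use n_ge in simp)
  finally show ?thesis .
qed

lemma quartic_0024: "X i * X i * X (i + 2) * X (i + 4) \<in> W"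
  using cyclic_quadrics.quartic_0244[OF mirror, of "- i - 4"] by (simp add: ac_simps)

text \<open>\<open>X i * X i\<close> times the adjacent quadric of \<open>i\<close>: the two other
  terms are \<open>quartic_0222\<close> at \<open>i - 2\<close> and
  \<open>quartic_0013\<close>.\<close>

lemma quartic_0001: "X i * X i * X i * X (i + 1) \<in> W"
proof -
  have "X i * X i * X i * X (i + 1) = X (i - 2) * X i * X i * X i + X i * X i * X (i + 1) * X (i + 3)
      + (X i * X i) * (X i * X (i + 1) - X (i - 2) * X i - X (i + 1) * X (i + 3))"
    by (simp add: algebra_simps)
  also have "\<dots> \<in> W"
    using quartic_0222[of "i - 2"]
    by (intro W_add quartic_0013 prod_in_W[OF square_in_Q] adjacent; simp add: mult_ac)
  finally show ?thesis .
qed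

lemma quartic_0111: "X i * X (i + 1) * X (i + 1) * X (i + 1) \<in> W"
  using cyclic_quadrics.quartic_0001[OF mirror, of "- i - 1"] by (simp add: ac_simps)

text \<open>In \<open>quartic_1001\<close> the leading 1 stands for the offset \<open>-1\<close>.\<close>

lemma quartic_1001: "X i * X i * X (i + 1) * X (i + 2) - X (i - 1) * X i * X i * X (i + 1) \<in> W"
proof -
  have "X i * X i * X (i + 1) * X (i + 2) - X (i - 1) * X i * X i * X (i + 1)
      = X i * X i * X (i + 2) * X (i + 4)
      + (X i * X i) * (X (i + 1) * X (i + 2) - X (i - 1) * X (i + 1) - X (i + 2) * X (i + 4))"
    by (simp add: algebra_simps)
  also have "\<dots> \<in> W"
    by (intro W_add quartic_0024 prod_in_W far adjacent; use n_ge in simp)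
  finally show ?thesis .
qed

lemma quartic_1001': "X i * X i * X (i - 1) * X (i - 2) - X (i + 1) * X i * X i * X (i - 1) \<in> W"
  using cyclic_quadrics.quartic_1001[OF mirror, of "- i"] by (simp add: ac_simps)

section \<open>Moving an edge along the cycle modulo \<open>W\<close>\<close>

definition edge_times :: "int \<Rightarrow> int \<Rightarrow> 'a"
  where "edge_times i j = X i * (X (j - 1) * X j * X (j + 1))"

text \<open>\<open>X i * X (i + s)\<close> times the adjacent quadric of \<open>i + s + 1\<close>
  contains both edges, which share two variables. Its last monomial splits into the pairs
  \<open>i, i + s + 2\<close> and \<open>i + s, i + s + 4\<close>; the first pair is distant only up
  to \<open>s = n - 5\<close>.\<close>

lemma edge_times_step:
  assumes "3 \<le> s" "s \<le> n - 5"
  shows "edge_times i (i + s + 1) - edge_times i (i + s) \<in> W"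
proof -
  have "edge_times i (i + s + 1) - edge_times i (i + s)
      = (X i * X (i + s)) * (X (i + s + 1) * X (i + s + 2) - X (i + s - 1) * X (i + s + 1)
          - X (i + s + 2) * X (i + s + 4))
      + (X i * X (i + s + 2)) * (X (i + s) * X (i + s + 4))"
    by (simp add: algebra_simps edge_times_def)
  also have "\<dots> \<in> W"
    using assms by (intro W_add prod_in_W far adjacent; use n_ge in simp)
  finally show ?thesis .
qed

lemma edge_times_cong:
  assumes "3 \<le> s" "s \<le> n - 4"
  shows "edge_times i (i + s) - edge_times i (i + 3) \<in> W"
  using assms
proof (induction s rule: int_ge_induct)
  case base
  show ?case by (simp add: W_zero)
next
  case (step s)
  then show ?case
    using W_add[OF edge_times_step[of s i] step.IH] by (simp add: add.assoc)
qed

lemma X_minus_n: "X (i - n) = X i"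
  using X_periodic[of "i - n"] by simp

lemma X_mod: "X (i mod n) = X i"
proof -
  have shift: "X (i + int k * n) = X i" for i k
  proof (induction k)
    case (Suc k)
    have "X (i + int (Suc k) * n) = X (i + int k * n + n)" by (simp add: algebra_simps)
    then show ?case using Suc X_periodic by simp
  qed simp
  have "i mod n + (i div n) * n = i" by simp
  show ?thesis
  proof (cases "i div n \<ge> 0")
    case True
    then show ?thesis using shift[of "i mod n" "nat (i div n)"] by simp
  next
    case False
    then have "X (i + int (nat (- (i div n))) * n) = X (i mod n)"
      by (simp add: minus_mult_div_eq_mod algebra_simps minus_div_mult_eq_mod)
    then show ?thesis using shift[of i "nat (- (i div n))"] by simp
  qed
qed

lemma in_Q_or_near: "X a * X b \<in> Q \<or> (\<exists>e\<in>{-2,-1,1,2}. X b = X (a + e))"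
proof -
  define s where "s = (b - a) mod n"
  have b: "X b = X (a + s)"
  proof -
    have "X (a + s) = X ((a + s) mod n)" by (simp add: X_mod)
    also have "(a + s) mod n = b mod n" unfolding s_def by (simp add: mod_simps)
    finally show ?thesis by (simp add: X_mod)
  qed
  have "0 \<le> s" "s < n" using n_ge by (simp_all add: s_def)
  then consider "s = 0 \<or> 3 \<le> s \<and> s \<le> n - 3" | "s = 1" | "s = 2" | "s = n - 2" | "s = n - 1"
    by linarith
  then show ?thesis
  proof cases
    case 1
    then have "X a * X (a + s) \<in> Q" by (intro far) auto
    then show ?thesis using b by simp
  next
    case 4
    then have "a + s = a + -2 + n" by simp
    then have "X (a + s) = X (a + -2)" by (simp only: X_periodic)
    then show ?thesis using b by simp
  next
    case 5
    then have "a + s = a + -1 + n" by simp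
    then have "X (a + s) = X (a + -1)" by (simp only: X_periodic)
    then show ?thesis using b by simp
  qed (use b in auto)
qed

lemma edge_times_minus: "edge_times i (i - s) = edge_times i (i + (n - s))"
  using X_minus_n[of "i + (n - s) - 1"] X_minus_n[of "i + (n - s)"] X_minus_n[of "i + (n - s) + 1"]
  by (simp add: edge_times_def algebra_simps)

lemma edge_times_mirror:
  "cyclic_quadrics.edge_times (\<lambda>i. X (- i)) (- i) (- i + s) = edge_times i (i - s)"
proof -
  interpret mirror: cyclic_quadrics n "\<lambda>i. X (- i)" Q W by (rule mirror)
  have "- (- i + s - 1) = i - s + 1" "- (- i + s) = i - s" "- (- i + s + 1) = i - s - 1"
    by simp_all
  then show ?thesis
    unfolding mirror.edge_times_def edge_times_def by (simp only: mult_ac minus_minus)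
qed

text \<open>The steps end at shift \<open>n - 4\<close>. Shift \<open>n - 3\<close> amounts to -3
  and is reached from the other side, in the mirrored arrangement; 9 lies on both walks.\<close>

lemma edge_times_far:
  assumes "3 \<le> s" "s \<le> n - 3"
  shows "edge_times i (i + s) - edge_times i (i + 9) \<in> W"
proof (cases "s = n - 3")
  case False
  then show ?thesis
    using W_diff[OF edge_times_cong[of s i] edge_times_cong[of 9 i]] assms n_ge by simp
next
  case True
  interpret mirror: cyclic_quadrics n "\<lambda>i. X (- i)" Q W by (rule mirror)
  have "edge_times i (i - (n - 9)) - edge_times i (i - 3) \<in> W"
    using mirror.edge_times_cong[of "n - 9" "- i"] n_ge by (simp only: edge_times_mirror)
  then have "edge_times i (i + 9) - edge_times i (i + s) \<in> W"
    using True by (simp add: edge_times_minus)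
  from W_diff[OF W_zero this] show ?thesis by simp
qed

end

text \<open>The target \<open>V\<close> stays open because it has two uses: in degree 4 it is the
  span of \<open>W\<close> and the class monomials, in degree 5 the set of elements that every
  variable multiplies into the target for quintics.\<close>

locale cyclic_quartics = cyclic_quadrics +
  fixes V :: "'a set"
  assumes W_subset_V: "W \<subseteq> V"
    and V_diff: "p \<in> V \<Longrightarrow> q \<in> V \<Longrightarrow> p - q \<in> V"
    and edge_times_in_V: "3 \<le> s \<Longrightarrow> s \<le> n - 3 \<Longrightarrow> edge_times i (i + s) \<in> V"
begin

lemma V_add: "p \<in> V \<Longrightarrow> q \<in> V \<Longrightarrow> p + q \<in> V"
  using V_diff[of p "0 - q"] V_diff[of 0] W_zero W_subset_V by auto

lemma V_add_W: "p \<in> V \<Longrightarrow> q \<in> W \<Longrightarrow> p + q \<in> V"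
  using V_add W_subset_V by blast

lemma edge_times_minus_in_V: "3 \<le> s \<Longrightarrow> s \<le> n - 3 \<Longrightarrow> edge_times i (i - s) \<in> V"
  using edge_times_in_V[of "n - s" i] by (simp add: edge_times_minus)

lemma mirror_quartics: "cyclic_quartics n (\<lambda>i. X (- i)) Q W V"
proof -
  interpret mirror: cyclic_quadrics n "\<lambda>i. X (- i)" Q W by (rule mirror)
  show ?thesis
  proof
    fix s i :: int
    assume "3 \<le> s" "s \<le> n - 3"
    then show "mirror.edge_times i (i + s) \<in> V"
      using edge_times_minus_in_V[of s "- i"] edge_times_mirror[of "- i" s] by simp
  qed (use W_subset_V V_diff in auto)
qed

section \<open>From distant edges to all quartic monomials\<close>

lemma quartic_0123: "X i * X (i + 1) * X (i + 2) * X (i + 3) \<in> V"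
proof -
  \<comment> \<open>\<open>X i * X (i + 3)\<close> times the adjacent quadric of
    \<open>i + 1\<close>: its two other terms are edges times a variable at distance 3 from the
    middle.\<close>
  have "X i * X (i + 1) * X (i + 2) * X (i + 3)
      = edge_times (i + 3) (i + 3 - 3) + edge_times i (i + 3)
      + (X i * X (i + 3)) * (X (i + 1) * X (i + 2) - X (i - 1) * X (i + 1) - X (i + 2) * X (i + 4))"
    by (simp add: algebra_simps edge_times_def)
  also have "\<dots> \<in> V"
    by (intro V_add_W V_add edge_times_in_V edge_times_minus_in_V prod_in_W far adjacent;
        use n_ge in simp)
  finally show ?thesis .
qed

lemma quartic_0012: "X i * X i * X (i + 1) * X (i + 2) \<in> V"
proof -
  \<comment> \<open>Here both factors are adjacent, those of \<open>i\<close> and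
    \<open>i - 1\<close>. The product contains \<open>X (i - 1) * X i * X i * X (i + 1)\<close> and
    \<open>X (i - 2) * X (i - 1) * X i * X i\<close> with opposite signs, and they cancel modulo
    \<open>W\<close> by \<open>quartic_1001'\<close>.\<close>
  have "X i * X i * X (i + 1) * X (i + 2)
      = X (i - 3) * X (i - 2) * X (i - 1) * X i + X i * X (i + 1) * X (i + 2) * X (i + 3)
      - edge_times (i - 3) (i - 3 + 3) - edge_times (i + 3) (i + 3 - 3)
      + (X (i - 2) * X (i + 2)) * (X i * X i) + (X (i - 3) * X (i + 1)) * (X (i - 1) * X (i + 3))
      - (X i * X i * X (i - 1) * X (i - 2) - X (i + 1) * X i * X i * X (i - 1))
      - (X i * X (i + 1) - X (i - 2) * X i - X (i + 1) * X (i + 3))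
        * (X (i - 1) * X i - X (i - 3) * X (i - 1) - X i * X (i + 2))"
    by (simp add: algebra_simps edge_times_def)
  also have "\<dots> \<in> V"
    using quartic_0123[of "i - 3"]
    by (intro V_add_W V_add V_diff quartic_0123 edge_times_in_V edge_times_minus_in_V
        subsetD[OF W_subset_V quartic_1001']
        subsetD[OF W_subset_V prod_in_W[OF adjacent adjacent]] prod_in_W[OF far far];
        use n_ge in simp)
  finally show ?thesis .
qed

lemma quartic_0112: "X i * X (i + 1) * X (i + 1) * X (i + 2) \<in> V"
proof -
  have "X (i + 1) * X (i + 1) * X (i + 2) * X (i + 3) \<in> V"
    using quartic_0012[of "i + 1"] by (simp add: add.assoc)
  moreover have "X (i + 1) * X (i + 1) * X (i + 2) * X (i + 3)
      - X i * X (i + 1) * X (i + 1) * X (i + 2) \<in> V"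
    using subsetD[OF W_subset_V quartic_1001[of "i + 1"]] by (simp add: add.assoc)
  ultimately show ?thesis using V_diff by fastforce
qed

lemma quartic_0122: "X i * X (i + 1) * X (i + 2) * X (i + 2) \<in> V"
  using cyclic_quartics.quartic_0012[OF mirror_quartics, of "- i - 2"] by (simp add: ac_simps)

text \<open>Distances are counted from the middle variable \<open>i + 1\<close>. From 3 to
  \<open>n - 3\<close> the assumption on \<open>V\<close> applies; otherwise \<open>X d\<close> lies
  on the edge or next to one of its ends.\<close>

lemma edge_times_all: "X i * X (i + 1) * X (i + 2) * X d \<in> V"
proof -
  define s where "s = (d - (i + 1)) mod n"
  have "X d = X (i + 1 + s)"
  proof -
    have "X (i + 1 + s) = X ((i + 1 + s) mod n)" by (simp add: X_mod)
    also have "(i + 1 + s) mod n = d mod n" unfolding s_def by (simp add: mod_simps)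
    finally show ?thesis by (simp add: X_mod)
  qed
  moreover have "0 \<le> s" "s < n" using n_ge by (simp_all add: s_def)
  then consider "s = 0" | "s = 1" | "s = 2" | "3 \<le> s" "s \<le> n - 3" | "s = n - 2" | "s = n - 1"
    by linarith
  then have "X i * X (i + 1) * X (i + 2) * X (i + 1 + s) \<in> V"
  proof cases
    case 4
    then show ?thesis using edge_times_minus_in_V[of s "i + 1 + s"]
      by (simp add: edge_times_def algebra_simps)
  next
    case 5
    then have "i + 1 + s = i - 1 + n" by simp
    then have "X (i + 1 + s) = X (i - 1)" by (simp only: X_periodic)
    then show ?thesis using quartic_0123[of "i - 1"] by (simp add: ac_simps)
  next
    case 6
    then have "i + 1 + s = i + n" by simp
    then have "X (i + 1 + s) = X i" by (simp only: X_periodic)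
    then show ?thesis using quartic_0012[of i] by (simp add: ac_simps)
  qed (use quartic_0112[of i] quartic_0122[of i] quartic_0123[of i] in \<open>simp_all add: algebra_simps\<close>)
  ultimately show ?thesis by simp
qed

text \<open>If two of the offsets form an edge together with 0, that is \<open>{1, 2}\<close>,
  \<open>{-1, 1}\<close> or \<open>{-2, -1}\<close>, then \<open>edge_times_all\<close> applies.
  Otherwise the offsets take at most two values, and the monomial is one of the ten quartics known
  to lie in \<open>W\<close>.\<close>

lemma star_in_V:
  assumes "e \<in> {-2,-1,1,2}" "e' \<in> {-2,-1,1,2}" "e'' \<in> {-2,-1,1,2}"
  shows "X a * X (a + e) * X (a + e') * X (a + e'') \<in> V"
proof -
  note W = quartic_0001[of "a - 1"] quartic_0111[of a] quartic_0002[of "a - 2"] quartic_0222[of a]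
    quartic_0023[of "a - 2"] quartic_0233[of "a - 2"] quartic_0013[of "a - 1"] quartic_0133[of "a - 1"]
    quartic_0024[of "a - 2"] quartic_0244[of "a - 2"]
  note V = W[THEN subsetD[OF W_subset_V]]
    edge_times_all[of a "a + e"] edge_times_all[of a "a + e'"] edge_times_all[of a "a + e''"]
    edge_times_all[of "a - 1" "a + e"] edge_times_all[of "a - 1" "a + e'"]
    edge_times_all[of "a - 1" "a + e''"] edge_times_all[of "a - 2" "a + e"]
    edge_times_all[of "a - 2" "a + e'"] edge_times_all[of "a - 2" "a + e''"]
  show ?thesis using assms V by (auto simp: ac_simps)
qed

text \<open>Offsets from \<open>{-2, -1, 1, 2}\<close> that differ by 1 or 2 form an edge together
  with 0, so three pairwise near variables are consecutive and \<open>edge_times_all\<close> absorbs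
  the fourth.\<close>

lemma triangle_in_V:
  assumes ab: "X a * X b \<notin> Q" and ac: "X a * X c \<notin> Q" and bc: "X b * X c \<notin> Q"
  shows "X a * X b * X c * X d \<in> V"
proof -
  obtain e where e: "e \<in> {-2,-1,1,2}" "X b = X (a + e)" using in_Q_or_near[of a b] ab by blast
  obtain e' where e': "e' \<in> {-2,-1,1,2}" "X c = X (a + e')" using in_Q_or_near[of a c] ac by blast
  have "\<not> (e = e' \<or> 3 \<le> \<bar>e - e'\<bar>)"
  proof
    assume "e = e' \<or> 3 \<le> \<bar>e - e'\<bar>"
    then have "X (a + e) * X (a + e') \<in> Q" using e(1) e'(1) n_ge by (intro far) auto
    with bc e e' show False by simp
  qed
  then show ?thesis
    using e e' edge_times_all[of a d] edge_times_all[of "a - 1" d] edge_times_all[of "a - 2" d]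
    by (auto simp: ac_simps)
qed

lemma near_star_in_V:
  assumes "X a * X b \<notin> Q" "X a * X c \<notin> Q" "X a * X d \<notin> Q"
  shows "X a * X b * X c * X d \<in> V"
proof -
  obtain e where "e \<in> {-2,-1,1,2}" "X b = X (a + e)" using in_Q_or_near assms(1) by blast
  moreover obtain e' where "e' \<in> {-2,-1,1,2}" "X c = X (a + e')"
    using in_Q_or_near assms(2) by blast
  moreover obtain e'' where "e'' \<in> {-2,-1,1,2}" "X d = X (a + e'')"
    using in_Q_or_near assms(3) by blast
  ultimately show ?thesis using star_in_V[of e e' e'' a] by metis
qed

text \<open>If no splitting of a quartic monomial into two pairs lies in \<open>W\<close>, one bad pair from each of
  the three splittings makes up a star or a triangle.\<close>

lemma quartic_in_V: "X a * X b * X c * X d \<in> V"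
proof -
  have comm: "X i * X j \<in> Q \<longleftrightarrow> X j * X i \<in> Q" for i j by (simp add: mult.commute)
  have split: "X i * X j * X k * X l \<in> V" if "X i * X j \<in> Q" "X k * X l \<in> Q" for i j k l
    using subsetD[OF W_subset_V prod_in_W[OF that]] by (simp add: mult.assoc)
  show ?thesis
    using split[of a b c d] split[of a c b d] split[of a d b c]
      near_star_in_V[of a b c d] near_star_in_V[of b a c d] near_star_in_V[of c a b d]
      near_star_in_V[of d a b c] triangle_in_V[of a b c d] triangle_in_V[of a b d c]
      triangle_in_V[of a c d b] triangle_in_V[of b c d a] comm
    by (simp only: mult_ac) argo
qed

end

text \<open>With \<open>V\<close> the set that every variable multiplies into \<open>W'\<close>, the
  reduction of quartics is reused, and only the classes of distant edges have to be checked.\<close>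

lemma (in cyclic_quadrics) quintic_in:
  assumes W': "\<And>v w. w \<in> W \<Longrightarrow> X v * w \<in> W'"
    and W'_diff: "\<And>p q. p \<in> W' \<Longrightarrow> q \<in> W' \<Longrightarrow> p - q \<in> W'"
  shows "X v * (X a * X b * X c * X d) \<in> W'"
proof -
  define V where "V = {p. \<forall>v. X v * p \<in> W'}"
  have V_diff: "p - q \<in> V" if "p \<in> V" "q \<in> V" for p q
    using that W'_diff by (auto simp: V_def right_diff_distrib)
  have W_V: "W \<subseteq> V" using W' by (auto simp: V_def)
  have V_add: "p + q \<in> V" if "p \<in> V" "q \<in> V" for p q
    using V_diff[OF that(1) V_diff[OF subsetD[OF W_V W_zero] that(2)]] by simp
  have base: "edge_times i (i + 9) \<in> V" for i
  proof -
    have "X v * edge_times i (i + 9) \<in> W'" for v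
    \<comment> \<open>A class may be represented by any distant edge. If \<open>X v\<close> pairs
      with \<open>X (i + 4)\<close>, the edge with middle \<open>i + 4\<close> works. Otherwise
      \<open>X v\<close> is among \<open>X (i + 2)\<close> to \<open>X (i + 6)\<close>, all at
      distance at least 3 from \<open>i + 9\<close>; hence the shift 9.\<close>
    proof (cases "X (i + 4) * X v \<in> Q")
      case True
      have "X v * edge_times i (i + 4) = X (i + 5) * ((X (i + 4) * X v) * (X i * X (i + 3)))"
        by (simp add: edge_times_def ac_simps)
      also have "\<dots> \<in> W'" by (intro W' prod_in_W True far) (use n_ge in simp)
      finally have 1: "X v * edge_times i (i + 4) \<in> W'" .
      have 2: "X v * (edge_times i (i + 4) - edge_times i (i + 9)) \<in> W'"
        by (intro W' edge_times_far) (use n_ge in auto)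
      show ?thesis using W'_diff[OF 1 2] by (simp add: right_diff_distrib)
    next
      case False
      then obtain e where e: "e \<in> {-2,-1,1,2}" "X v = X (i + 4 + e)"
        using in_Q_or_near by blast
      have "X v * edge_times i (i + 9)
          = X (i + 10) * ((X (i + 4 + e) * X (i + 9)) * (X i * X (i + 8)))"
        by (simp add: edge_times_def e(2) ac_simps)
      also have "\<dots> \<in> W'" by (intro W' prod_in_W far) (use e n_ge in auto)
      finally show ?thesis .
    qed
    then show ?thesis by (simp add: V_def)
  qed
  interpret cyclic_quartics n X Q W V
  proof
    fix s i
    assume "3 \<le> s" "s \<le> n - 3"
    from V_add[OF subsetD[OF W_V edge_times_far[OF this, of i]] base[of i]]
    show "edge_times i (i + s) \<in> V" by simp
  qed (use W_V V_diff in auto)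
  show ?thesis using quartic_in_V by (simp add: V_def)
qed

section \<open>Hilbert functions from bases\<close>

lemma poly_ring_simps [simp]:
  "mult (poly_ring V) = (*)" "one (poly_ring V) = 1" "zero (poly_ring V) = 0"
  "add (poly_ring V) = (+)"
  by (simp_all add: poly_ring_def)

lemma carrier_poly_ring: "p \<in> carrier (poly_ring V) \<longleftrightarrow> keys p \<subseteq> exponents V"
  by (simp add: poly_ring_def)

lemma poly_ring_carrier_closed:
  shows "0 \<in> carrier (poly_ring V)" "1 \<in> carrier (poly_ring V)"
    and "const_poly c \<in> carrier (poly_ring V)"
    and "p \<in> carrier (poly_ring V) \<Longrightarrow> q \<in> carrier (poly_ring V) \<Longrightarrow> p + q \<in> carrier (poly_ring V)"
    and "p \<in> carrier (poly_ring V) \<Longrightarrow> q \<in> carrier (poly_ring V) \<Longrightarrow> p * q \<in> carrier (poly_ring V)"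
    and "p \<in> carrier (poly_ring V) \<Longrightarrow> - p \<in> carrier (poly_ring V)"
    and "p \<in> carrier (poly_ring V) \<Longrightarrow> q \<in> carrier (poly_ring V) \<Longrightarrow> p - q \<in> carrier (poly_ring V)"
proof -
  interpret cring "poly_ring V" by (rule poly_ring_is_cring)
  show "0 \<in> carrier (poly_ring V)" "1 \<in> carrier (poly_ring V)" using zero_closed one_closed by simp_all
  show "const_poly c \<in> carrier (poly_ring V)"
    by (simp add: carrier_poly_ring const_poly_def exponents_def)
  show *: "p \<in> carrier (poly_ring V) \<Longrightarrow> q \<in> carrier (poly_ring V) \<Longrightarrow> p + q \<in> carrier (poly_ring V)"
    for p q using a_closed[of p q] by simp
  show "p \<in> carrier (poly_ring V) \<Longrightarrow> q \<in> carrier (poly_ring V) \<Longrightarrow> p * q \<in> carrier (poly_ring V)"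
    using m_closed[of p q] by simp
  show neg: "p \<in> carrier (poly_ring V) \<Longrightarrow> - p \<in> carrier (poly_ring V)" for p
    by (simp add: carrier_poly_ring in_keys_iff subset_iff)
  show "p \<in> carrier (poly_ring V) \<Longrightarrow> q \<in> carrier (poly_ring V) \<Longrightarrow> p - q \<in> carrier (poly_ring V)"
    using *[of p "- q"] neg[of q] by simp
qed

lemma poly_ring_carrier_sum:
  "(\<And>x. x \<in> A \<Longrightarrow> h x \<in> carrier (poly_ring V)) \<Longrightarrow> (\<Sum>x\<in>A. h x) \<in> carrier (poly_ring V)"
  by (induction A rule: infinite_finite_induct) (simp_all add: poly_ring_carrier_closed)

lemma poly_ring_a_inv:
  assumes "p \<in> carrier (poly_ring V)"
  shows "\<ominus>\<^bsub>poly_ring V\<^esub> p = - p"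
proof -
  interpret cring "poly_ring V" by (rule poly_ring_is_cring)
  show ?thesis using minus_equality[of "- p" p] assms by (simp add: poly_ring_carrier_closed)
qed

lemma subfield_const_poly: "subfield (range const_poly) (poly_ring V :: (('v \<Rightarrow>\<^sub>0 nat) \<Rightarrow>\<^sub>0 'k::field) ring)"
proof -
  let ?R = "poly_ring V :: (('v \<Rightarrow>\<^sub>0 nat) \<Rightarrow>\<^sub>0 'k) ring"
  interpret cring ?R by (rule poly_ring_is_cring)
  have inv: "const_poly c * const_poly (inverse c) = (1 :: ('v \<Rightarrow>\<^sub>0 nat) \<Rightarrow>\<^sub>0 'k)" if "c \<noteq> 0" for c :: 'k
    using that by (simp flip: const_poly_simps)
  show ?thesis
  proof (rule subfieldI)
    have "subring (range const_poly) ?R"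
    proof (rule subringI)
      fix h :: "('v \<Rightarrow>\<^sub>0 nat) \<Rightarrow>\<^sub>0 'k"
      assume "h \<in> range const_poly"
      then obtain c where "h = const_poly c" by blast
      then show "\<ominus>\<^bsub>?R\<^esub> h \<in> range const_poly"
        by (auto simp: poly_ring_a_inv poly_ring_carrier_closed simp flip: const_poly_simps)
    qed (auto simp: poly_ring_carrier_closed simp flip: const_poly_simps)
    then show "subcring (range const_poly) ?R"
      by (rule subcringI) (auto simp: mult.commute)
    show "Units (?R\<lparr>carrier := range const_poly\<rparr>) = range const_poly - {\<zero>\<^bsub>?R\<^esub>}"
    proof (intro equalityI subsetI)
      fix u :: "('v \<Rightarrow>\<^sub>0 nat) \<Rightarrow>\<^sub>0 'k"
      assume u: "u \<in> range const_poly - {\<zero>\<^bsub>?R\<^esub>}"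
      then obtain c where c: "u = const_poly c" by auto
      then have "c \<noteq> 0" using u by auto
      with c show "u \<in> Units (?R\<lparr>carrier := range const_poly\<rparr>)"
        using inv[of c] by (auto simp: Units_def mult.commute intro!: bexI[of _ "const_poly (inverse c)"])
    qed (auto simp: Units_def)
  qed
qed

text \<open>Trades the dimension over a field inside the quotient ring for spanning and independence
  modulo \<open>J\<close>, stated for polynomials. That 1 is not in \<open>J\<close> makes the image
  of the constants a field.\<close>

lemma hilbert_function_eqI:
  fixes J :: "((nat \<Rightarrow>\<^sub>0 nat) \<Rightarrow>\<^sub>0 'k::field) set" and m :: "nat \<Rightarrow> (nat \<Rightarrow>\<^sub>0 nat) \<Rightarrow>\<^sub>0 'k"
  assumes ideal: "ideal J (S_ring n)" and proper: "1 \<notin> J"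
    and m: "\<And>j. j < N \<Longrightarrow> m j \<in> carrier (S_ring n)" "\<And>j. j < N \<Longrightarrow> homogeneous_of_degree i (m j)"
    and spanning: "\<And>p. p \<in> carrier (S_ring n) \<Longrightarrow> homogeneous_of_degree i p \<Longrightarrow>
      \<exists>c. p - (\<Sum>j<N. const_poly (c j) * m j) \<in> J"
    and independent: "\<And>c j. (\<Sum>j<N. const_poly (c j) * m j) \<in> J \<Longrightarrow> j < N \<Longrightarrow> c j = 0"
  shows "hilbert_function n J i = N"
proof -
  define R where "R = (S_ring n :: ((nat \<Rightarrow>\<^sub>0 nat) \<Rightarrow>\<^sub>0 'k) ring)"
  define h where "h p = J +>\<^bsub>R\<^esub> p" for p
  interpret cring R unfolding R_def by (rule poly_ring_is_cring)
  interpret J: ideal J R using ideal by (simp add: R_def)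
  interpret hom: ring_hom_ring R "R Quot J" h
    unfolding h_def by (rule J.rcos_ring_hom_ring)
  have closed: "const_poly c \<in> carrier R" "p \<in> carrier R \<Longrightarrow> q \<in> carrier R \<Longrightarrow> p - q \<in> carrier R"
    for c p q by (simp_all add: R_def poly_ring_carrier_closed)
  have comb_closed: "(\<Sum>j<k. const_poly (c j) * m j) \<in> carrier R" if "k \<le> N" for c k
    unfolding R_def using m that by (intro poly_ring_carrier_sum poly_ring_carrier_closed) auto
  have h_add: "h (p + q) = h p \<oplus>\<^bsub>R Quot J\<^esub> h q" if "p \<in> carrier R" "q \<in> carrier R" for p q
    using hom.hom_add[OF that] by (simp add: R_def)
  have h_mult: "h (p * q) = h p \<otimes>\<^bsub>R Quot J\<^esub> h q" if "p \<in> carrier R" "q \<in> carrier R" for p q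
    using hom.hom_mult[OF that] by (simp add: R_def)
  have h_zero: "h 0 = \<zero>\<^bsub>R Quot J\<^esub>" using hom.hom_zero by (simp add: R_def)
  have h_J: "h p = \<zero>\<^bsub>R Quot J\<^esub> \<longleftrightarrow> p \<in> J" if "p \<in> carrier R" for p
    using that J.a_rcos_self[of p] J.a_rcos_const[of p] by (auto simp: h_def FactRing_def)
  have h_eq: "h p = h q \<longleftrightarrow> p - q \<in> J" if "p \<in> carrier R" "q \<in> carrier R" for p q
  proof -
    have d: "p - q \<in> carrier R" using that closed by simp
    have "h p = h (p - q) \<oplus>\<^bsub>R Quot J\<^esub> h q" using h_add[OF d that(2)] by simp
    then have "h p = h q \<longleftrightarrow> h (p - q) = \<zero>\<^bsub>R Quot J\<^esub>"
      using hom.S.add.r_cancel_one'[of "h q" "h (p - q)"] that d by auto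
    with h_J[OF d] show ?thesis by simp
  qed
  define K where "K = h ` range const_poly"
  have "\<one>\<^bsub>R Quot J\<^esub> \<noteq> \<zero>\<^bsub>R Quot J\<^esub>"
    using h_J[OF one_closed] proper hom.hom_one by (simp add: R_def)
  then have K: "subfield K (R Quot J)"
    unfolding K_def using hom.img_is_subfield(2) subfield_const_poly R_def by blast
  \<comment> \<open>Spans of the first \<open>k\<close> classes follow the inductive definition of
    dimension, whose step asks only that the new class lies outside the previous span.\<close>
  define E where "E k = range (\<lambda>c. h (\<Sum>j<k. const_poly (c j) * m j))" for k
  have "hom.S.dimension k K (E k)" if "k \<le> N" for k
    using that
  proof (induction k)
    case 0
    have "E 0 = {\<zero>\<^bsub>R Quot J\<^esub>}" by (auto simp: E_def h_zero)
    then show ?case by simp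
  next
    case (Suc k)
    have mk: "m k \<in> carrier R" using m Suc.prems by (simp add: R_def)
    have "h (m k) \<notin> E k"
    proof
      assume "h (m k) \<in> E k"
      then obtain c where "h (m k) = h (\<Sum>j<k. const_poly (c j) * m j)" by (auto simp: E_def)
      then have "m k - (\<Sum>j<k. const_poly (c j) * m j) \<in> J"
        using h_eq mk comb_closed[of k c] Suc.prems by simp
      also have "m k - (\<Sum>j<k. const_poly (c j) * m j)
          = (\<Sum>j<N. const_poly (if j < k then - c j else if j = k then 1 else 0) * m j)"
      proof -
        have "(\<Sum>j<N. const_poly (if j < k then - c j else if j = k then 1 else 0) * m j)
            = (\<Sum>j<Suc k. const_poly (if j < k then - c j else if j = k then 1 else 0) * m j)"
          using Suc.prems by (intro sum.mono_neutral_right) auto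
        also have "\<dots> = m k - (\<Sum>j<k. const_poly (c j) * m j)"
          by (simp add: sum_negf)
        finally show ?thesis by simp
      qed
      finally show False using independent[of _ k] Suc.prems by fastforce
    qed
    then have "hom.S.dimension (Suc k) K (hom.S.line_extension K (h (m k)) (E k))"
      using Suc mk by (intro hom.S.dimension.Suc_dim) auto
    also have "hom.S.line_extension K (h (m k)) (E k) = E (Suc k)"
    proof -
      have *: "h (const_poly a) \<otimes>\<^bsub>R Quot J\<^esub> h (m k)
          \<oplus>\<^bsub>R Quot J\<^esub> h (\<Sum>j<k. const_poly (c j) * m j)
          = h (const_poly a * m k + (\<Sum>j<k. const_poly (c j) * m j))" for a c
        using comb_closed[of k c] Suc.prems mk closed(1)[of a] m_closed[OF closed(1) mk]
        by (simp add: h_add h_mult R_def)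
      show ?thesis
      proof (intro equalityI subsetI)
        fix x assume "x \<in> hom.S.line_extension K (h (m k)) (E k)"
        then obtain a c where "x = h (const_poly a * m k + (\<Sum>j<k. const_poly (c j) * m j))"
          using * by (auto simp: hom.S.line_extension_def set_add_def' r_coset_def K_def E_def)
        then have "x = h (\<Sum>j<Suc k. const_poly ((c(k := a)) j) * m j)" by (simp add: add.commute)
        then show "x \<in> E (Suc k)" unfolding E_def by blast
      next
        fix x assume "x \<in> E (Suc k)"
        then obtain c where "x = h (const_poly (c k) * m k + (\<Sum>j<k. const_poly (c j) * m j))"
          by (auto simp: E_def add.commute)
        then show "x \<in> hom.S.line_extension K (h (m k)) (E k)"
          using *[of "c k" c]
          by (auto simp: hom.S.line_extension_def set_add_def' r_coset_def K_def E_def)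
      qed
    qed
    finally show ?case .
  qed
  from this[of N] have "hom.S.dimension N K (E N)" by simp
  moreover have "E N = graded_piece n J i"
  proof (intro equalityI subsetI)
    fix x assume "x \<in> E N"
    then obtain c where c: "x = h (\<Sum>j<N. const_poly (c j) * m j)" by (auto simp: E_def)
    have "homogeneous_of_degree i (\<Sum>j<N. const_poly (c j) * m j)"
      unfolding homogeneous_of_degree_def
    proof
      fix a assume "a \<in> keys (\<Sum>j<N. const_poly (c j) * m j)"
      then have "(\<Sum>j<N. c j * lookup (m j) a) \<noteq> 0"
        by (simp add: in_keys_iff lookup_sum lookup_const_mult)
      then obtain j where "j < N" "c j * lookup (m j) a \<noteq> 0"
        by (meson lessThan_iff sum.not_neutral_contains_not_neutral)
      then show "exponent_degree a = i"
        using m(2)[of j] by (auto simp: homogeneous_of_degree_def in_keys_iff)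
    qed
    then show "x \<in> graded_piece n J i"
      using c comb_closed[of N c] by (auto simp: graded_piece_def h_def R_def)
  next
    fix x assume "x \<in> graded_piece n J i"
    then obtain p where p: "p \<in> carrier R" "homogeneous_of_degree i p" "x = h p"
      by (auto simp: graded_piece_def h_def R_def)
    with spanning[of p] obtain c where "p - (\<Sum>j<N. const_poly (c j) * m j) \<in> J"
      by (auto simp: R_def)
    then have "x = h (\<Sum>j<N. const_poly (c j) * m j)"
      using h_eq[OF p(1) comb_closed] p(3) by simp
    then show "x \<in> E N" by (auto simp: E_def)
  qed
  ultimately have "hom.S.dim K (graded_piece n J i) = N"
    using hom.S.dimI[OF K, of N "graded_piece n J i"] by (simp add: over_def)
  moreover have "K = range (\<lambda>c. J +>\<^bsub>S_ring n\<^esub> const_poly c)"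
    by (auto simp: K_def h_def R_def)
  ultimately show ?thesis by (simp add: hilbert_function_def R_def)
qed

section \<open>Apolarity as orthogonality\<close>

text \<open>The constant coefficient of the contraction of \<open>f\<close> by \<open>s\<close>;
  multiplying \<open>s\<close> by monomials gives the other coefficients.\<close>

definition pairing :: "('a \<Rightarrow>\<^sub>0 'k) \<Rightarrow> ('a \<Rightarrow>\<^sub>0 'k) \<Rightarrow> 'k::field"
  where "pairing f s = (\<Sum>b\<in>keys s. lookup s b * lookup f b)"

lemma pairing_add: "pairing f (s + t) = pairing f s + pairing f t"
  unfolding pairing_def by (rule sum_keys_add) (simp_all add: distrib_right)

lemma pairing_zero [simp]: "pairing f 0 = 0"
  by (simp add: pairing_def)

lemma pairing_single: "pairing f (Poly_Mapping.single b c) = c * lookup f b"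
  by (simp add: pairing_def)

lemma pairing_const_mult: "pairing f (const_poly c * s) = c * pairing f s"
  by (induction s rule: poly_additive_induct)
    (simp_all add: const_poly_def mult_single pairing_single distrib_left pairing_add mult.assoc)

lemma pairing_diff: "pairing f (s - t) = pairing f s - pairing f t"
  using pairing_add[of f "s - t" t] by simp

lemma pairing_sum: "pairing f (\<Sum>x\<in>A. h x) = (\<Sum>x\<in>A. pairing f (h x))"
  by (induction A rule: infinite_finite_induct) (simp_all add: pairing_add)

lemma pairing_mult_mon: "pairing f (s * mon c) = (\<Sum>b\<in>keys s. lookup s b * lookup f (b + c))"
proof (induction s rule: poly_additive_induct)
  case (single b d)
  show ?case by (simp add: mult_single pairing_single)
next
  case (add s t)
  have "(\<Sum>b\<in>keys (s + t). lookup (s + t) b * lookup f (b + c))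
      = (\<Sum>b\<in>keys s. lookup s b * lookup f (b + c)) + (\<Sum>b\<in>keys t. lookup t b * lookup f (b + c))"
    by (rule sum_keys_add) (simp_all add: distrib_right)
  with add show ?case by (simp add: distrib_right pairing_add)
qed

lemma lookup_contract:
  fixes s f :: "('v \<Rightarrow>\<^sub>0 nat) \<Rightarrow>\<^sub>0 'k::field"
  shows "lookup (contract s f) c = pairing f (s * mon c)"
proof -
  have eq: "lookup (contract_monomial b a) c = (if a = b + c then 1 else 0 :: 'k)" for a b
  proof (cases "\<forall>v. lookup b v \<le> lookup a v")
    case True
    then have "a - b = c \<longleftrightarrow> a = b + c"
      by (auto simp: poly_mapping_eq_iff fun_eq_iff lookup_minus lookup_add)
        (metis le_add_diff_inverse)
    with True show ?thesis by (simp add: contract_monomial_def lookup_single when_def)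
  next
    case False
    then have "a \<noteq> b + c" by (auto simp: lookup_add)
    with False show ?thesis by (auto simp: contract_monomial_def)
  qed
  have map: "lookup (Poly_Mapping.map ((*) d) p) c = d * lookup p c" for d :: 'k and p :: "('v \<Rightarrow>\<^sub>0 nat) \<Rightarrow>\<^sub>0 'k"
    by (simp add: map.rep_eq when_def)
  have "lookup (contract s f) c
      = (\<Sum>b\<in>keys s. \<Sum>a\<in>keys f. if a = b + c then lookup s b * lookup f a else 0)"
    unfolding contract_def lookup_sum map eq by (intro sum.cong) auto
  also have "\<dots> = (\<Sum>b\<in>keys s. lookup s b * lookup f (b + c))"
    by (intro sum.cong) (auto simp: in_keys_iff)
  finally show ?thesis by (simp add: pairing_mult_mon)
qed

text \<open>Annihilation becomes orthogonality of \<open>f\<close> to all multiples of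
  \<open>s\<close>. Here \<open>t\<close> also ranges over polynomials outside
  \<open>S_ring n\<close>, so that cofactors such as derivatives need no membership check.\<close>

lemma Ann_iff: "s \<in> Ann n f \<longleftrightarrow> s \<in> carrier (S_ring n) \<and> (\<forall>t. pairing f (s * t) = 0)"
proof -
  have "contract s f = 0 \<longleftrightarrow> (\<forall>t. pairing f (s * t) = 0)"
  proof
    assume "contract s f = 0"
    then have mon: "pairing f (s * mon c) = 0" for c by (simp flip: lookup_contract)
    show "\<forall>t. pairing f (s * t) = 0"
    proof
      fix t
      show "pairing f (s * t) = 0"
      proof (induction t rule: poly_additive_induct)
        case (single c d)
        have "s * Poly_Mapping.single c d = const_poly d * (s * mon c)"
          by (metis const_mult_mon mult.left_commute)
        then show ?case by (simp only: pairing_const_mult mon mult_zero_right)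
      qed (simp add: distrib_left pairing_add)
    qed
  next
    assume "\<forall>t. pairing f (s * t) = 0"
    then show "contract s f = 0" by (intro poly_mapping_eqI) (simp add: lookup_contract)
  qed
  then show ?thesis by (auto simp: Ann_def)
qed

lemma Ann_closed:
  "s \<in> Ann n f \<Longrightarrow> t \<in> Ann n f \<Longrightarrow> s + t \<in> Ann n f"
  "s \<in> Ann n f \<Longrightarrow> t \<in> carrier (S_ring n) \<Longrightarrow> s * t \<in> Ann n f"
  "s \<in> Ann n f \<Longrightarrow> - s \<in> Ann n f"
  "0 \<in> Ann n f"
proof -
  show "s + t \<in> Ann n f" if "s \<in> Ann n f" "t \<in> Ann n f"
    using that by (simp add: Ann_iff poly_ring_carrier_closed distrib_right pairing_add)
  show mult: "s * t \<in> Ann n f" if "s \<in> Ann n f" "t \<in> carrier (S_ring n)" for t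
    using that by (simp add: Ann_iff poly_ring_carrier_closed mult.assoc)
  show "- s \<in> Ann n f" if "s \<in> Ann n f"
    using mult[OF that, of "- 1"] poly_ring_carrier_closed(2,6) by fastforce
  show "0 \<in> Ann n f" by (simp add: Ann_iff poly_ring_carrier_closed)
qed

lemma ideal_Ann: "ideal (Ann n f) (S_ring n)"
proof -
  interpret cring "S_ring n :: ((nat \<Rightarrow>\<^sub>0 nat) \<Rightarrow>\<^sub>0 'a) ring" by (rule poly_ring_is_cring)
  show ?thesis
  proof (rule idealI)
    show "ring (S_ring n :: ((nat \<Rightarrow>\<^sub>0 nat) \<Rightarrow>\<^sub>0 'a) ring)" ..
    show "subgroup (Ann n f) (add_monoid (S_ring n))"
    proof (rule add.subgroupI)
      show "Ann n f \<noteq> {}" using Ann_closed(4) by blast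
      fix a assume "a \<in> Ann n f"
      then show "\<ominus>\<^bsub>S_ring n\<^esub> a \<in> Ann n f"
        using Ann_closed(3) by (simp add: Ann_iff poly_ring_a_inv)
    qed (use Ann_closed(1) in \<open>auto simp: Ann_iff\<close>)
  qed (use Ann_closed in \<open>auto simp: mult.commute\<close>)
qed

lemma ideal_Ann_square: "ideal (Ann n f \<cdot>\<^bsub>S_ring n\<^esub> Ann n f) (S_ring n)"
proof -
  interpret cring "S_ring n :: ((nat \<Rightarrow>\<^sub>0 nat) \<Rightarrow>\<^sub>0 'a) ring" by (rule poly_ring_is_cring)
  show ?thesis by (intro ideal_prod_is_ideal ideal_Ann)
qed

lemma Ann_square_subset: "Ann n f \<cdot>\<^bsub>S_ring n\<^esub> Ann n f \<subseteq> Ann n f"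
proof -
  interpret cring "S_ring n :: ((nat \<Rightarrow>\<^sub>0 nat) \<Rightarrow>\<^sub>0 'a) ring" by (rule poly_ring_is_cring)
  show ?thesis using ideal_prod_inter[OF ideal_Ann ideal_Ann] by blast
qed

lemma exponent_degree_add: "exponent_degree (a + b) = exponent_degree a + exponent_degree b"
  unfolding exponent_degree_def by (rule sum_keys_add) auto

lemma exponent_degree_single [simp]: "exponent_degree (Poly_Mapping.single v k) = k"
  by (simp add: exponent_degree_def)

lemma exponents_add: "a + b \<in> exponents V \<longleftrightarrow> a \<in> exponents V \<and> b \<in> exponents V"
  by (auto simp: exponents_def in_keys_iff lookup_add subset_iff)

lemma lookup_cubic_eq_0:
  assumes "f \<in> cubics n" "\<not> (a \<in> exponents {..<n} \<and> exponent_degree a = 3)"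
  shows "lookup f a = 0"
  using assms by (auto simp: cubics_def divided_powers_def homogeneous_of_degree_def in_keys_iff)

text \<open>The coefficient at \<open>c\<close> of the contraction involves \<open>f\<close> in
  degree \<open>d + exponent_degree c\<close> only. Above degree 3 there is nothing to check, so all
  forms of degree at least 4 annihilate \<open>f\<close>.\<close>

lemma Ann_homogeneousI:
  assumes f: "f \<in> cubics n" and s: "s \<in> carrier (S_ring n)" "homogeneous_of_degree d s"
    and zero: "\<And>c. c \<in> exponents {..<n} \<Longrightarrow> d + exponent_degree c = 3 \<Longrightarrow> pairing f (s * mon c) = 0"
  shows "s \<in> Ann n f"
proof -
  have "contract s f = 0"
  proof (rule poly_mapping_eqI)
    fix c
    show "lookup (contract s f) c = lookup 0 c"
    proof (cases "c \<in> exponents {..<n} \<and> d + exponent_degree c = 3")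
      case True
      then show ?thesis using zero by (simp add: lookup_contract)
    next
      case False
      have "lookup f (b + c) = 0" if "b \<in> keys s" for b
        using that s False
        by (intro lookup_cubic_eq_0[OF f])
          (auto simp: exponents_add exponent_degree_add homogeneous_of_degree_def)
      then show ?thesis by (simp add: lookup_contract pairing_mult_mon)
    qed
  qed
  then show ?thesis using s by (simp add: Ann_def)
qed

section \<open>Derivations of the square of the annihilator\<close>

text \<open>The ordinary derivative, not contraction. Where \<open>v\<close> does not occur in
  \<open>a\<close> the subtraction truncates, but then the coefficient is 0.\<close>

definition partial_deriv :: "'v \<Rightarrow> (('v \<Rightarrow>\<^sub>0 nat) \<Rightarrow>\<^sub>0 'k) \<Rightarrow> (('v \<Rightarrow>\<^sub>0 nat) \<Rightarrow>\<^sub>0 'k::field)"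
  where "partial_deriv v p = (\<Sum>a\<in>keys p.
    Poly_Mapping.single (a - Poly_Mapping.single v 1) (of_nat (lookup a v) * lookup p a))"

lemma partial_deriv_add: "partial_deriv v (p + q) = partial_deriv v p + partial_deriv v q"
  unfolding partial_deriv_def by (rule sum_keys_add) (simp_all add: distrib_left single_add)

lemma partial_deriv_zero [simp]: "partial_deriv v 0 = 0"
  by (simp add: partial_deriv_def)

lemma partial_deriv_single:
  "partial_deriv v (Poly_Mapping.single a c)
    = Poly_Mapping.single (a - Poly_Mapping.single v 1) (of_nat (lookup a v) * c)"
  by (simp add: partial_deriv_def)

lemma partial_deriv_mult:
  "partial_deriv v (p * q) = partial_deriv v p * q + p * partial_deriv v q"
proof (induction p rule: poly_additive_induct)
  case (single a c)
  show ?case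
  proof (induction q rule: poly_additive_induct)
    case (single b d)
    define e where "e = Poly_Mapping.single v (1::nat)"
    have shift: "x + y - e = (x - e) + y" if "lookup x v \<noteq> 0" for x y :: "'a \<Rightarrow>\<^sub>0 nat"
      using that by (intro poly_mapping_eqI) (auto simp: e_def lookup_add lookup_minus lookup_single when_def)
    have "Poly_Mapping.single (a + b - e) (of_nat (lookup a v) * (c * d))
        = Poly_Mapping.single (a - e + b) (of_nat (lookup a v) * (c * d))"
      by (cases "lookup a v = 0") (simp_all add: shift)
    moreover have "Poly_Mapping.single (a + b - e) (of_nat (lookup b v) * (c * d))
        = Poly_Mapping.single (a + (b - e)) (of_nat (lookup b v) * (c * d))"
      using shift[of b a] by (cases "lookup b v = 0") (simp_all add: add.commute)
    ultimately show ?case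
      by (simp add: mult_single partial_deriv_single e_def[symmetric, simplified] lookup_add
          distrib_left distrib_right single_add ac_simps)
  qed (simp add: distrib_left partial_deriv_add)
qed (simp add: distrib_right partial_deriv_add)

lemma partial_deriv_const [simp]: "partial_deriv v (const_poly c) = 0"
  by (simp add: const_poly_def partial_deriv_single)

lemma partial_deriv_sum: "partial_deriv v (\<Sum>x\<in>A. h x) = (\<Sum>x\<in>A. partial_deriv v (h x))"
  by (induction A rule: infinite_finite_induct) (simp_all add: partial_deriv_add)

lemma pairing_partial_deriv_Ann_square:
  assumes "s \<in> Ann n f \<cdot>\<^bsub>S_ring n\<^esub> Ann n f"
  shows "pairing f (partial_deriv v s) = 0"
  using assms
proof (induction rule: ideal_prod.induct)
  case (prod p q)
  then have "pairing f (q * partial_deriv v p) = 0" "pairing f (p * partial_deriv v q) = 0"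
    by (simp_all add: Ann_iff)
  then show ?case by (simp add: partial_deriv_mult pairing_add mult.commute)
qed (simp add: partial_deriv_add pairing_add)

section \<open>Monomials of a given degree\<close>

definition exponents_of_degree :: "nat \<Rightarrow> nat \<Rightarrow> (nat \<Rightarrow>\<^sub>0 nat) set"
  where "exponents_of_degree n d = {a \<in> exponents {..<n}. exponent_degree a = d}"

lemma exponents_of_degree_add:
  "a \<in> exponents_of_degree n d \<Longrightarrow> b \<in> exponents_of_degree n e \<Longrightarrow> a + b \<in> exponents_of_degree n (d + e)"
  by (simp add: exponents_of_degree_def exponents_add exponent_degree_add)

lemma exponents_of_degree_0: "exponents_of_degree n 0 = {0}"
  by (auto simp: exponents_of_degree_def exponent_degree_def exponents_def in_keys_iff
      poly_mapping_eq_iff fun_eq_iff)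

lemma exponents_of_degree_Suc:
  "exponents_of_degree n (Suc d)
    = (\<lambda>(i, b). Poly_Mapping.single i 1 + b) ` ({..<n} \<times> exponents_of_degree n d)"
proof (intro equalityI subsetI)
  fix a assume a: "a \<in> exponents_of_degree n (Suc d)"
  then have "exponent_degree a \<noteq> 0" by (simp add: exponents_of_degree_def)
  then obtain i where i: "i \<in> keys a" unfolding exponent_degree_def by fastforce
  let ?b = "a - Poly_Mapping.single i 1"
  have eq: "a = Poly_Mapping.single i 1 + ?b"
    using i by (intro poly_mapping_eqI) (auto simp: lookup_add lookup_minus lookup_single when_def in_keys_iff)
  have "?b \<in> exponents {..<n}" "exponent_degree ?b = d"
  proof -
    show "?b \<in> exponents {..<n}"
      using a eq exponents_add[of "Poly_Mapping.single i 1" ?b] by (simp add: exponents_of_degree_def)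
    show "exponent_degree ?b = d"
      using a eq exponent_degree_add[of "Poly_Mapping.single i 1" ?b]
      by (simp add: exponents_of_degree_def)
  qed
  moreover have "i < n" using i a by (auto simp: exponents_of_degree_def exponents_def)
  ultimately show "a \<in> (\<lambda>(i, b). Poly_Mapping.single i 1 + b) ` ({..<n} \<times> exponents_of_degree n d)"
    using eq by (auto simp: exponents_of_degree_def image_iff)
next
  fix a assume "a \<in> (\<lambda>(i, b). Poly_Mapping.single i 1 + b) ` ({..<n} \<times> exponents_of_degree n d)"
  then show "a \<in> exponents_of_degree n (Suc d)"
    by (auto simp: exponents_of_degree_def exponents_add exponent_degree_add)
      (auto simp: exponents_def)
qed

lemma finite_exponents_of_degree: "finite (exponents_of_degree n d)"
  by (induction d) (simp_all add: exponents_of_degree_0 exponents_of_degree_Suc)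

lemma keys_subset_exponents_of_degree:
  "keys p \<subseteq> exponents_of_degree n d \<longleftrightarrow> p \<in> carrier (S_ring n) \<and> homogeneous_of_degree d p"
  by (auto simp: carrier_poly_ring homogeneous_of_degree_def exponents_of_degree_def)

lemma keys_const_mult_subset: "keys (const_poly c * p) \<subseteq> keys p"
  by (auto simp: in_keys_iff lookup_const_mult)

lemma keys_mult_exponents_of_degree:
  assumes "keys p \<subseteq> exponents_of_degree n d" "keys q \<subseteq> exponents_of_degree n e"
  shows "keys (p * q) \<subseteq> exponents_of_degree n (d + e)"
  using keys_mult[of p q] assms exponents_of_degree_add by blast

lemma sum_monomials:
  assumes "finite A" "keys p \<subseteq> A"
  shows "p = (\<Sum>a\<in>A. const_poly (lookup p a) * mon a)"
proof (rule poly_mapping_eqI)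
  fix b
  have "lookup (\<Sum>a\<in>A. const_poly (lookup p a) * mon a) b = (\<Sum>a\<in>A. if a = b then lookup p a else 0)"
    by (simp add: lookup_sum lookup_const_mult lookup_single when_def if_distrib cong: if_cong)
  also have "\<dots> = lookup p b" using assms by (auto simp: in_keys_iff)
  finally show "lookup p b = lookup (\<Sum>a\<in>A. const_poly (lookup p a) * mon a) b" by simp
qed

section \<open>Linear spans of families of polynomials\<close>

definition lin_span ::
    "'j set \<Rightarrow> ('j \<Rightarrow> ('v \<Rightarrow>\<^sub>0 nat) \<Rightarrow>\<^sub>0 'k) \<Rightarrow> (('v \<Rightarrow>\<^sub>0 nat) \<Rightarrow>\<^sub>0 'k::field) set"
  where "lin_span J F = {p. \<exists>c. p = (\<Sum>j\<in>J. const_poly (c j) * F j)}"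

lemma lin_span_diff:
  assumes "p \<in> lin_span J F" "q \<in> lin_span J F"
  shows "p - q \<in> lin_span J F"
proof -
  obtain c d where "p = (\<Sum>j\<in>J. const_poly (c j) * F j)" "q = (\<Sum>j\<in>J. const_poly (d j) * F j)"
    using assms by (auto simp: lin_span_def)
  then have "p - q = (\<Sum>j\<in>J. const_poly (c j - d j) * F j)"
    by (simp add: left_diff_distrib sum_subtractf)
  then show ?thesis unfolding lin_span_def by (intro CollectI exI[of _ "\<lambda>j. c j - d j"])
qed

lemma lin_span_const_mult:
  assumes "p \<in> lin_span J F"
  shows "const_poly a * p \<in> lin_span J F"
proof -
  obtain c where "p = (\<Sum>j\<in>J. const_poly (c j) * F j)"
    using assms by (auto simp: lin_span_def)
  then have "const_poly a * p = (\<Sum>j\<in>J. const_poly (a * c j) * F j)"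
    by (simp add: sum_distrib_left mult.assoc)
  then show ?thesis unfolding lin_span_def by (intro CollectI exI[of _ "\<lambda>j. a * c j"])
qed

lemma lin_span_zero: "0 \<in> lin_span J F"
  unfolding lin_span_def by (auto intro!: exI[of _ "\<lambda>_. 0"])

lemma lin_span_add:
  assumes "p \<in> lin_span J F" "q \<in> lin_span J F"
  shows "p + q \<in> lin_span J F"
  using lin_span_diff[OF assms(1) lin_span_diff[OF lin_span_zero assms(2)]] by simp

lemma lin_span_sum: "(\<And>x. x \<in> A \<Longrightarrow> h x \<in> lin_span J F) \<Longrightarrow> (\<Sum>x\<in>A. h x) \<in> lin_span J F"
  by (induction A rule: infinite_finite_induct) (simp_all add: lin_span_zero lin_span_add)

lemma lin_span_base:
  assumes "finite J" "j \<in> J"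
  shows "F j \<in> lin_span J F"
proof -
  have "(\<Sum>i\<in>J. const_poly (if i = j then 1 else 0) * F i) = (\<Sum>i\<in>J. if i = j then F i else 0)"
    by (intro sum.cong) auto
  also have "\<dots> = F j" using assms by simp
  finally show ?thesis unfolding lin_span_def by (auto intro!: exI[of _ "\<lambda>i. if i = j then 1 else 0"])
qed

lemma lin_span_subset:
  assumes "\<And>j. j \<in> J \<Longrightarrow> F j \<in> lin_span J' F'"
  shows "lin_span J F \<subseteq> lin_span J' F'"
proof
  fix p assume "p \<in> lin_span J F"
  then show "p \<in> lin_span J' F'"
    using assms by (auto simp: lin_span_def[of J] intro!: lin_span_sum lin_span_const_mult)
qed

lemma in_lin_span_monomials:
  assumes "finite A" "keys p \<subseteq> A" "\<And>a. a \<in> A \<Longrightarrow> mon a \<in> lin_span J F"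
  shows "p \<in> lin_span J F"
  by (subst sum_monomials[OF assms(1,2)]) (intro lin_span_sum lin_span_const_mult assms(3))

section \<open>Families of polynomials with regular coefficients\<close>

text \<open>The support bound does not depend on \<open>f\<close>; it turns a product into a sum
  over a fixed finite index set, with regular coefficients.\<close>

definition regular_poly ::
    "nat \<Rightarrow> (((nat \<Rightarrow>\<^sub>0 nat) \<Rightarrow>\<^sub>0 'k) \<Rightarrow> (nat \<Rightarrow>\<^sub>0 nat) \<Rightarrow>\<^sub>0 'k::field) \<Rightarrow> bool"
  where "regular_poly n F \<longleftrightarrow>
    (\<exists>A. finite A \<and> (\<forall>f. keys (F f) \<subseteq> A)) \<and> (\<forall>a. regular_fun n (\<lambda>f. lookup (F f) a))"

lemma regular_poly_const: "regular_poly n (\<lambda>_. p)"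
  by (auto simp: regular_poly_def regular_fun_const intro!: exI[of _ "keys p"])

lemma regular_poly_const_mult:
  assumes "regular_fun n h" "regular_poly n F"
  shows "regular_poly n (\<lambda>f. const_poly (h f) * F f)"
proof -
  obtain A where "finite A" "\<And>f. keys (F f) \<subseteq> A"
    using assms(2) unfolding regular_poly_def by blast
  then have "finite A \<and> (\<forall>f. keys (const_poly (h f) * F f) \<subseteq> A)"
    using keys_const_mult_subset by fast
  then show ?thesis
    using assms by (auto simp: regular_poly_def lookup_const_mult intro!: regular_fun_mult)
qed

lemma regular_poly_diff:
  assumes "regular_poly n F" "regular_poly n G"
  shows "regular_poly n (\<lambda>f. F f - G f)"
proof -
  obtain A B where AB: "finite A" "\<forall>f. keys (F f) \<subseteq> A" "finite B" "\<forall>f. keys (G f) \<subseteq> B"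
    using assms unfolding regular_poly_def by blast
  have "keys (F f - G f) \<subseteq> A \<union> B" for f
    using keys_diff[of "F f" "G f"] AB(2,4) by blast
  then show ?thesis using assms AB(1,3)
    by (auto simp: regular_poly_def lookup_minus intro!: regular_fun_diff exI[of _ "A \<union> B"])
qed

lemma regular_poly_add:
  assumes "regular_poly n F" "regular_poly n G"
  shows "regular_poly n (\<lambda>f. F f + G f)"
  using regular_poly_diff[OF assms(1) regular_poly_diff[OF regular_poly_const[of n 0] assms(2)]]
  by simp

lemma regular_poly_sum:
  "(\<And>x. x \<in> A \<Longrightarrow> regular_poly n (F x)) \<Longrightarrow> regular_poly n (\<lambda>f. \<Sum>x\<in>A. F x f)"
  by (induction A rule: infinite_finite_induct) (simp_all add: regular_poly_const regular_poly_add)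

lemma regular_poly_mult:
  assumes "regular_poly n F" "regular_poly n G"
  shows "regular_poly n (\<lambda>f. F f * G f)"
proof -
  obtain A B where A: "finite A" "\<And>f. keys (F f) \<subseteq> A" and B: "finite B" "\<And>f. keys (G f) \<subseteq> B"
    using assms unfolding regular_poly_def by blast
  have eq: "F f * G f
      = (\<Sum>a\<in>A. \<Sum>b\<in>B. const_poly (lookup (F f) a * lookup (G f) b) * mon (a + b))" for f
  proof -
    have "F f * G f = (\<Sum>a\<in>A. const_poly (lookup (F f) a) * mon a) * (\<Sum>b\<in>B. const_poly (lookup (G f) b) * mon b)"
      using sum_monomials[OF A(1) A(2)[of f]] sum_monomials[OF B(1) B(2)[of f]] by simp
    also have "\<dots> = (\<Sum>a\<in>A. \<Sum>b\<in>B.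
        const_poly (lookup (F f) a * lookup (G f) b) * (mon a * mon b))"
      by (simp only: sum_product const_poly_simps mult_ac)
    finally show ?thesis by (simp add: mult_single)
  qed
  have "regular_fun n (\<lambda>f. lookup (F f) a)" "regular_fun n (\<lambda>f. lookup (G f) a)" for a
    using assms by (simp_all add: regular_poly_def)
  then show ?thesis unfolding eq
    by (intro regular_poly_sum regular_poly_const_mult regular_fun_mult regular_poly_const)
qed

lemmas regular_poly_intros = regular_poly_sum regular_poly_diff regular_poly_mult
  regular_poly_const_mult regular_poly_const

text \<open>\<open>regular_elimination\<close> for the coefficient matrix, with rows
  \<open>J\<close> and the monomials in \<open>A\<close> as columns. Where \<open>g\<close> does not
  vanish, dividing by it recovers each monomial.\<close>

lemma spanning_open:
  assumes "finite J" "\<And>j. j \<in> J \<Longrightarrow> regular_poly n (F j)" "finite A"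
    and keys: "\<And>j f. j \<in> J \<Longrightarrow> keys (F j f) \<subseteq> A"
    and span: "\<And>a. a \<in> A \<Longrightarrow> mon a \<in> lin_span J (\<lambda>j. F j f\<^sub>0)"
  shows "\<exists>g. regular_fun n g \<and> g f\<^sub>0 \<noteq> 0 \<and>
    (\<forall>f p. g f \<noteq> 0 \<longrightarrow> keys p \<subseteq> A \<longrightarrow> p \<in> lin_span J (\<lambda>j. F j f))"
proof -
  have coeff: "lookup (\<Sum>j\<in>J. const_poly (c j) * F j f) a = (\<Sum>j\<in>J. c j * lookup (F j f) a)" for c f a
    by (simp add: lookup_sum lookup_const_mult)
  have "\<exists>c. \<forall>b\<in>A. (\<Sum>j\<in>J. c j * lookup (F j f\<^sub>0) b) = (if a = b then 1 else 0)" if a: "a \<in> A" for a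
  proof -
    obtain c where c: "mon a = (\<Sum>j\<in>J. const_poly (c j) * F j f\<^sub>0)"
      using span[OF a] by (auto simp: lin_span_def)
    show ?thesis
    proof (intro exI[of _ c] ballI)
      fix b
      have "(\<Sum>j\<in>J. c j * lookup (F j f\<^sub>0) b) = lookup (mon a) b" by (simp only: c coeff)
      then show "(\<Sum>j\<in>J. c j * lookup (F j f\<^sub>0) b) = (if a = b then 1 else 0)"
        by (simp add: lookup_single when_def)
    qed
  qed
  moreover have "regular_fun n (\<lambda>f. lookup (F j f) a)" if "j \<in> J" for j a
    using assms(2)[OF that] by (simp add: regular_poly_def)
  ultimately obtain g where g: "regular_fun n g" "g f\<^sub>0 \<noteq> 0"
    and c: "\<forall>a\<in>A. \<exists>c. (\<forall>j\<in>J. regular_fun n (c j)) \<and>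
      (\<forall>f. \<forall>b\<in>A. (\<Sum>j\<in>J. c j f * lookup (F j f) b) = (if a = b then g f else 0))"
    using regular_elimination[OF assms(3,1), where v = "\<lambda>j a f. lookup (F j f) a" and n = n and f\<^sub>0 = f\<^sub>0]
    by blast
  have "mon a \<in> lin_span J (\<lambda>j. F j f)" if "g f \<noteq> 0" "a \<in> A" for f a
  proof -
    obtain c where c: "\<And>b. b \<in> A \<Longrightarrow>
        (\<Sum>j\<in>J. c j f * lookup (F j f) b) = (if a = b then g f else 0)"
      using c \<open>a \<in> A\<close> by blast
    have "mon a = (\<Sum>j\<in>J. const_poly (c j f / g f) * F j f)"
    proof (rule poly_mapping_eqI)
      fix b
      have "(\<Sum>j\<in>J. c j f / g f * lookup (F j f) b) = (\<Sum>j\<in>J. c j f * lookup (F j f) b) / g f"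
        by (simp add: sum_divide_distrib)
      also have "\<dots> = (if a = b then 1 else 0)"
      proof (cases "b \<in> A")
        case False
        then have "lookup (F j f) b = 0" if "j \<in> J" for j
          using keys[OF that, of f] by (auto simp: in_keys_iff)
        with False \<open>a \<in> A\<close> show ?thesis by auto
      qed (use c that in auto)
      finally show "lookup (mon a) b = lookup (\<Sum>j\<in>J. const_poly (c j f / g f) * F j f) b"
        by (simp only: coeff) (simp add: lookup_single when_def)
    qed
    then show ?thesis unfolding lin_span_def by (intro CollectI exI[of _ "\<lambda>j. c j f / g f"])
  qed
  with g show ?thesis using in_lin_span_monomials[OF assms(3)] by blast
qed

section \<open>The cyclic cubic\<close>

locale cyclic_arrangement =
  fixes n :: nat
  assumes n_ge_18: "n \<ge> 18"
begin

definition var :: "int \<Rightarrow> nat \<Rightarrow>\<^sub>0 nat"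
  where "var i = Poly_Mapping.single (nat (i mod int n)) 1"

definition edge :: "int \<Rightarrow> nat \<Rightarrow>\<^sub>0 nat"
  where "edge t = var t + var (t + 1) + var (t + 2)"

definition cyclic_cubic :: "(nat \<Rightarrow>\<^sub>0 nat) \<Rightarrow>\<^sub>0 'k::field"
  where "cyclic_cubic = (\<Sum>t<n. mon (edge (int t)))"

lemma n_pos: "int n > 0" using n_ge_18 by simp

lemma lookup_var: "lookup (var i) v = (if int v = i mod int n then 1 else 0)"
  using n_pos by (auto simp: var_def lookup_single when_def)

lemma var_eq_iff: "var i = var j \<longleftrightarrow> int n dvd i - j"
proof -
  have "var i = var j \<longleftrightarrow> nat (i mod int n) = nat (j mod int n)"
    by (metis lookup_single_eq lookup_single_not_eq one_neq_zero var_def)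
  also have "\<dots> \<longleftrightarrow> i mod int n = j mod int n" using n_pos by (simp add: nat_eq_iff)
  finally show ?thesis by (simp add: mod_eq_dvd_iff)
qed

lemma lookup_var_at: "lookup (var i) (nat (j mod int n)) = (if var i = var j then 1 else 0)"
proof -
  have "int (nat (j mod int n)) = j mod int n" using n_pos by simp
  then have "lookup (var i) (nat (j mod int n)) = (if j mod int n = i mod int n then 1 else 0)"
    unfolding lookup_var by presburger
  then show ?thesis by (simp add: var_eq_iff mod_eq_dvd_iff dvd_diff_commute)
qed

lemma var_periodic: "var (i + int n) = var i"
  by (simp add: var_eq_iff)

lemma var_neq: "0 < \<bar>i - j\<bar> \<Longrightarrow> \<bar>i - j\<bar> < int n \<Longrightarrow> var i \<noteq> var j"
  by (auto simp: var_eq_iff dest: dvd_imp_le_int[rotated])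

lemma var_of_nat: "v < n \<Longrightarrow> var (int v) = Poly_Mapping.single v 1"
  by (simp add: var_def)

lemma var_obtain: obtains v where "v < n" "var i = var (int v)"
proof
  show "nat (i mod int n) < n" using n_pos by (simp add: nat_less_iff)
  show "var i = var (int (nat (i mod int n)))" using n_pos by (simp add: var_def)
qed

lemma var_degree: "var i \<in> exponents_of_degree n 1"
  using n_pos by (simp add: var_def exponents_of_degree_def exponents_def nat_less_iff)

lemma var_add_eq:
  assumes "var i + var j = var k + var l"
  shows "var i = var k \<and> var j = var l \<or> var i = var l \<and> var j = var k"
proof -
  let ?v = "nat (i mod int n)"
  have "lookup (var i + var j) ?v \<noteq> 0" by (simp add: lookup_add lookup_var_at)
  then have "lookup (var k) ?v \<noteq> 0 \<or> lookup (var l) ?v \<noteq> 0" by (simp add: assms lookup_add)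
  then have "var i = var k \<or> var i = var l"
    by (auto simp: lookup_var_at split: if_splits)
  then show ?thesis using assms by (metis add.commute add_left_cancel)
qed

lemma var_add_eq_iff:
  "var i + var j = var k + var l \<longleftrightarrow> var i = var k \<and> var j = var l \<or> var i = var l \<and> var j = var k"
  using var_add_eq by (metis add.commute)

lemma edge_cong: "var i = var j \<Longrightarrow> edge i = edge j"
proof -
  assume "var i = var j"
  then have "var (i + d) = var (j + d)" for d by (simp add: var_eq_iff)
  from this[of 0] this[of 1] this[of 2] show ?thesis by (simp add: edge_def)
qed

lemma edge_var:
  assumes "lookup (edge t) (nat (i mod int n)) \<noteq> 0"
  obtains r where "r \<in> {0,1,2}" "var i = var (t + r)"
proof -
  have "var t = var i \<or> var (t + 1) = var i \<or> var (t + 2) = var i"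
    using assms by (auto simp: edge_def lookup_add lookup_var_at split: if_splits)
  then show thesis using that[of 0] that[of 1] that[of 2] by auto
qed

text \<open>The edges through \<open>i\<close> start at \<open>i\<close>, \<open>i - 1\<close> and
  \<open>i - 2\<close>; each pair \<open>(p, q)\<close> holds the offsets of the other two
  variables.\<close>

lemma edge_iff:
  "(\<exists>t. var i + var j + var k = edge t) \<longleftrightarrow>
    (\<exists>(p, q)\<in>{(1, 2), (-1, 1), (-2, -1)}.
      var j = var (i + p) \<and> var k = var (i + q) \<or> var j = var (i + q) \<and> var k = var (i + p))"
proof
  assume "\<exists>t. var i + var j + var k = edge t"
  then obtain t where t: "var i + var j + var k = edge t" by blast
  have "lookup (var i + var j + var k) (nat (i mod int n)) \<noteq> 0"
    by (simp add: lookup_add lookup_var_at)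
  then obtain r where r: "r \<in> {0,1,2}" "var i = var (t + r)" unfolding t by (rule edge_var)
  then have "edge t = edge (i - r)" by (intro edge_cong) (simp add: var_eq_iff algebra_simps dvd_diff_commute)
  with t have "var i + (var j + var k) = var (i - r) + var (i - r + 1) + var (i - r + 2)"
    by (simp add: edge_def add.assoc)
  with r(1) have "var i + (var j + var k) = var i + (var (i + 1) + var (i + 2))
    \<or> var i + (var j + var k) = var i + (var (i + -1) + var (i + 1))
    \<or> var i + (var j + var k) = var i + (var (i + -2) + var (i + -1))"
    by (auto simp: ac_simps)
  then show "\<exists>(p, q)\<in>{(1, 2), (-1, 1), (-2, -1)}.
      var j = var (i + p) \<and> var k = var (i + q) \<or> var j = var (i + q) \<and> var k = var (i + p)"
    by (simp only: add_left_cancel var_add_eq_iff) auto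
next
  assume "\<exists>(p, q)\<in>{(1, 2), (-1, 1), (-2, -1)}.
      var j = var (i + p) \<and> var k = var (i + q) \<or> var j = var (i + q) \<and> var k = var (i + p)"
  then have "var i + var j + var k = edge i \<or> var i + var j + var k = edge (i - 1)
      \<or> var i + var j + var k = edge (i - 2)"
    by (auto simp: edge_def ac_simps)
  then show "\<exists>t. var i + var j + var k = edge t" by blast
qed

text \<open>Keeps the summands of \<open>cyclic_cubic\<close> apart, so that its coefficients are 0
  and 1 in every characteristic. For a shift by 1 or 2, cancelling the common variables would
  identify variables that are distinct modulo \<open>n\<close>.\<close>

lemma edge_inj: "edge s = edge t \<Longrightarrow> var s = var t"
proof -
  assume st: "edge s = edge t"
  have "lookup (edge s) (nat (s mod int n)) \<noteq> 0" unfolding edge_def lookup_add lookup_var_at by simp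
  then obtain r where r: "r \<in> {0,1,2}" "var s = var (t + r)" unfolding st by (rule edge_var)
  then have eq: "edge (t + r) = edge t" using edge_cong[of s "t + r"] st by simp
  consider "r = 0" | "r = 1" | "r = 2" using r(1) by blast
  then show "var s = var t"
  proof cases
    case 1
    with r show ?thesis by simp
  next
    case 2
    with eq have "var (t + 1) + var (t + 2) + var (t + 3) = var (t + 1) + var (t + 2) + var t"
      by (simp add: edge_def ac_simps)
    then show ?thesis using var_neq[of "t + 3" t] n_ge_18 by simp
  next
    case 3
    with eq have "var (t + 2) + (var (t + 3) + var (t + 4)) = var (t + 2) + (var t + var (t + 1))"
      by (simp add: edge_def ac_simps)
    then show ?thesis
      using var_neq[of "t + 3" t] var_neq[of "t + 3" "t + 1"] n_ge_18 by (simp add: var_add_eq_iff)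
  qed
qed

lemma lookup_cyclic_cubic: "lookup cyclic_cubic a = (if \<exists>t. a = edge t then 1 else 0 :: 'k::field)"
proof (cases "\<exists>t. a = edge t")
  case True
  then obtain t where t: "a = edge t" by blast
  obtain v where v: "v < n" "var t = var (int v)" by (rule var_obtain)
  have a: "a = edge (int v)" using t edge_cong[OF v(2)] by simp
  have "edge (int u) = a \<longleftrightarrow> u = v" if "u < n" for u
  proof
    assume "edge (int u) = a"
    then have "var (int u) = var (int v)" using edge_inj[of "int u" "int v"] a by blast
    then show "u = v" using var_neq[of "int u" "int v"] that v(1) by force
  qed (simp add: a)
  then have "lookup (cyclic_cubic :: (nat \<Rightarrow>\<^sub>0 nat) \<Rightarrow>\<^sub>0 'k) a = (\<Sum>u<n. if u = v then 1 else 0)"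
    unfolding cyclic_cubic_def lookup_sum
    by (intro sum.cong) (simp_all add: lookup_single when_def)
  then show ?thesis using True v(1) by simp
next
  case False
  then have "edge (int u) \<noteq> a" for u by metis
  with False show ?thesis by (simp add: cyclic_cubic_def lookup_sum lookup_single)
qed

lemma lookup_cyclic_cubic_edge [simp]: "lookup cyclic_cubic (edge t) = (1 :: 'k::field)"
  by (auto simp: lookup_cyclic_cubic)

lemma cyclic_cubic_far:
  assumes "d = 0 \<or> 3 \<le> d \<and> d \<le> int n - 3"
  shows "lookup cyclic_cubic (var i + var (i + d) + var k) = (0 :: 'k::field)"
proof -
  have "var (i + d) \<noteq> var (i + p)" if "p \<in> {-2,-1,1,2}" for p
    using that assms n_ge_18 by (intro var_neq) auto
  from this[of "-2"] this[of "-1"] this[of 1] this[of 2]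
  have "\<not> (\<exists>t. var i + var (i + d) + var k = edge t)" unfolding edge_iff by simp
  then show ?thesis unfolding lookup_cyclic_cubic by simp
qed

lemma cyclic_cubic_adjacent:
  "lookup cyclic_cubic (var i + var (i + 1) + var k)
    = (if var k = var (i - 1) then 1 else 0) + (if var k = var (i + 2) then 1 else 0 :: 'k::field)"
proof -
  have "var (i + 1) \<noteq> var (i + p)" if "p \<in> {-2,-1,2}" for p
    using that n_ge_18 by (intro var_neq) auto
  from this[of "-2"] this[of "-1"] this[of 2]
  have "(\<exists>t. var i + var (i + 1) + var k = edge t) \<longleftrightarrow> var k = var (i - 1) \<or> var k = var (i + 2)"
    unfolding edge_iff by auto
  moreover have "var (i - 1) \<noteq> var (i + 2)" using n_ge_18 by (intro var_neq) auto
  ultimately show ?thesis unfolding lookup_cyclic_cubic by auto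
qed

text \<open>The outer variables of the edge with middle \<open>j\<close>. No other edge contains
  both, so these \<open>n\<close> quadrics are dual to the variables under
  \<open>cyclic_cubic\<close>.\<close>

definition dual_pair :: "int \<Rightarrow> nat \<Rightarrow>\<^sub>0 nat"
  where "dual_pair j = var (j - 1) + var (j + 1)"

lemma dual_pair_cong: "var i = var j \<Longrightarrow> dual_pair i = dual_pair j"
proof -
  assume "var i = var j"
  then have "var (i + d) = var (j + d)" for d by (simp add: var_eq_iff)
  from this[of "-1"] this[of 1] show ?thesis by (simp add: dual_pair_def)
qed

lemma dual_pair_degree: "dual_pair j \<in> exponents_of_degree n 2"
  using exponents_of_degree_add[OF var_degree var_degree] by (simp add: dual_pair_def numeral_2_eq_2)

lemma cyclic_cubic_dual_pair:
  "lookup cyclic_cubic (dual_pair j + var i) = (if var i = var j then 1 else 0 :: 'k::field)"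
proof -
  have "var (j + 1) \<noteq> var (j - 1 + p)" if "p \<in> {-2,-1,1}" for p
    using that n_ge_18 by (intro var_neq) auto
  from this[of "-2"] this[of "-1"] this[of 1]
  have "(\<exists>t. var (j - 1) + var (j + 1) + var i = edge t) \<longleftrightarrow> var i = var j"
    unfolding edge_iff by (auto simp: add.commute)
  then show ?thesis unfolding lookup_cyclic_cubic dual_pair_def by auto
qed

end

section \<open>Quadrics annihilating a cubic near the cyclic one\<close>

lemma pairing_linear:
  "pairing f ((p - q) * t) = pairing f (p * t) - pairing f (q * t)"
  "pairing f ((\<Sum>x\<in>A. h x) * t) = (\<Sum>x\<in>A. pairing f (h x * t))"
  "pairing f (const_poly c * p * t) = c * pairing f (p * t)"
  "pairing f (mon a * mon b) = lookup f (a + b)"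
  by (simp_all add: left_diff_distrib pairing_diff sum_distrib_right pairing_sum mult.assoc
      pairing_const_mult mult_single pairing_single)

lemma (in cyclic_arrangement) var_of_degree_1:
  assumes "a \<in> exponents_of_degree n 1"
  obtains v where "v < n" "a = var (int v)"
  using assms var_of_nat by (auto simp: exponents_of_degree_Suc exponents_of_degree_0)

lemma (in cyclic_arrangement) var_plus_of_degree:
  assumes "a \<in> exponents_of_degree n (Suc d)"
  obtains i b where "a = var i + b" "b \<in> exponents_of_degree n d"
proof -
  obtain v b where "v < n" "b \<in> exponents_of_degree n d" "a = Poly_Mapping.single v 1 + b"
    using assms by (auto simp: exponents_of_degree_Suc)
  then show thesis using that[of "int v" b] by (simp add: var_of_nat)
qed

lemma (in cyclic_arrangement) regular_fun_dual_pair: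
  "regular_fun n (\<lambda>f. lookup f (dual_pair i + var j))"
  using exponents_of_degree_add[OF dual_pair_degree var_degree]
  by (intro regular_fun_lookup) (simp_all add: exponents_of_degree_def)

context cyclic_arrangement
begin

text \<open>The edge is far from \<open>var j\<close> on both sides since \<open>n \<ge> 18\<close>.\<close>

definition class_monomial :: "int \<Rightarrow> nat \<Rightarrow>\<^sub>0 nat"
  where "class_monomial j = var j + edge (j + 8)"

lemma edge_degree: "edge t \<in> exponents_of_degree n 3"
  using exponents_of_degree_add[OF exponents_of_degree_add[OF var_degree var_degree] var_degree]
  by (simp add: edge_def numeral_eq_Suc)

lemma class_monomial_degree: "class_monomial j \<in> exponents_of_degree n 4"
  using exponents_of_degree_add[OF var_degree edge_degree] by (simp add: class_monomial_def)

end

text \<open>\<open>c\<close> and \<open>g\<close> act as adjugate and determinant of the matrix of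
  coefficients of \<open>f\<close> at \<open>dual_pair j + var y\<close>, which is the identity for
  \<open>cyclic_cubic\<close>; they come from elimination.\<close>

locale dual_inverse = cyclic_arrangement +
  fixes g :: "((nat \<Rightarrow>\<^sub>0 nat) \<Rightarrow>\<^sub>0 'k::field) \<Rightarrow> 'k"
    and c :: "nat \<Rightarrow> nat \<Rightarrow> ((nat \<Rightarrow>\<^sub>0 nat) \<Rightarrow>\<^sub>0 'k) \<Rightarrow> 'k"
  assumes g_regular: "regular_fun n g" and g_cyclic_cubic: "g cyclic_cubic \<noteq> 0"
    and c_regular: "x < n \<Longrightarrow> j < n \<Longrightarrow> regular_fun n (c x j)"
    and inverse: "x < n \<Longrightarrow> y < n \<Longrightarrow>
      (\<Sum>j<n. c x j f * lookup f (dual_pair (int j) + var (int y))) = (if x = y then g f else 0)"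
begin

text \<open>Up to the factor \<open>g f\<close> this is \<open>q\<close> minus the combination of dual pairs that has the same
  contraction with \<open>f\<close>.\<close>

definition gen :: "(nat \<Rightarrow>\<^sub>0 nat) \<Rightarrow> ((nat \<Rightarrow>\<^sub>0 nat) \<Rightarrow>\<^sub>0 'k) \<Rightarrow> (nat \<Rightarrow>\<^sub>0 nat) \<Rightarrow>\<^sub>0 'k"
  where "gen q f = const_poly (g f) * mon q
    - (\<Sum>x<n. const_poly (lookup f (q + var (int x)))
        * (\<Sum>j<n. const_poly (c x j f) * mon (dual_pair (int j))))"

lemma gen_homogeneous:
  assumes "q \<in> exponents_of_degree n 2"
  shows "keys (gen q f) \<subseteq> exponents_of_degree n 2"
proof
  fix a assume "a \<in> keys (gen q f)"
  then have "a = q \<or> (\<exists>j. a = dual_pair (int j))"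
  proof (rule contrapos_pp)
    assume "\<not> (a = q \<or> (\<exists>j. a = dual_pair (int j)))"
    then have "lookup (mon q) a = (0::'k)" "lookup (mon (dual_pair (int j))) a = (0::'k)" for j
      by (auto simp: lookup_single when_def)
    then show "a \<notin> keys (gen q f)"
      by (simp add: gen_def in_keys_iff lookup_minus lookup_sum lookup_const_mult)
  qed
  then show "a \<in> exponents_of_degree n 2" using assms dual_pair_degree by auto
qed

lemma regular_poly_gen:
  assumes "q \<in> exponents_of_degree n 2"
  shows "regular_poly n (gen q)"
proof -
  have "regular_fun n (\<lambda>f. lookup f (q + var (int x)))" for x
    using exponents_of_degree_add[OF assms var_degree]
    by (intro regular_fun_lookup) (simp_all add: exponents_of_degree_def)
  then show ?thesis unfolding gen_def
    by (intro regular_poly_intros g_regular c_regular) auto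
qed

text \<open>By \<open>inverse\<close>, the subtracted sum contracts \<open>f\<close> to
  \<open>g f\<close> times the contraction by \<open>q\<close>. With the denominator cleared this is
  true on all cubics, also where \<open>g\<close> vanishes.\<close>

lemma gen_in_Ann:
  assumes f: "f \<in> cubics n" and q: "q \<in> exponents_of_degree n 2"
  shows "gen q f \<in> Ann n f"
proof (rule Ann_homogeneousI[OF f])
  show "gen q f \<in> carrier (S_ring n)" "homogeneous_of_degree 2 (gen q f)"
    using gen_homogeneous[OF q] by (simp_all add: keys_subset_exponents_of_degree)
  fix a assume "a \<in> exponents {..<n}" "2 + exponent_degree a = 3"
  then have "a \<in> exponents_of_degree n 1" by (simp add: exponents_of_degree_def)
  then obtain y where y: "y < n" "a = var (int y)" by (rule var_of_degree_1)
  have "pairing f (gen q f * mon a) = g f * lookup f (q + var (int y))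
      - (\<Sum>x<n. lookup f (q + var (int x)) * (if x = y then g f else 0))"
    using y(1) unfolding gen_def pairing_linear y(2)
    by (intro arg_cong2[where f = minus] refl sum.cong) (simp add: inverse)
  also have "(\<Sum>x<n. lookup f (q + var (int x)) * (if x = y then g f else 0))
      = (\<Sum>x<n. if x = y then lookup f (q + var (int y)) * g f else 0)"
    by (intro sum.cong) auto
  finally show "pairing f (gen q f * mon a) = 0" using y(1) by simp
qed

text \<open>The matrix inverted by \<open>c\<close> is the identity here, so \<open>c\<close> is
  \<open>g cyclic_cubic\<close> times the identity and that constant factors out.\<close>

lemma gen_cyclic_cubic:
  "gen q cyclic_cubic = const_poly (g cyclic_cubic) * (mon q
    - (\<Sum>x<n. const_poly (lookup cyclic_cubic (q + var (int x))) * mon (dual_pair (int x))))"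
proof -
  have "c x y cyclic_cubic = (if x = y then g cyclic_cubic else 0)" if "x < n" "y < n" for x y
  proof -
    have eq: "var (int y) = var (int j) \<longleftrightarrow> j = y" if "j < n" for j
      using var_neq[of "int y" "int j"] \<open>y < n\<close> that by force
    have "(\<Sum>j<n. c x j cyclic_cubic * lookup cyclic_cubic (dual_pair (int j) + var (int y)))
        = (\<Sum>j<n. if j = y then c x j cyclic_cubic else 0)"
      by (intro sum.cong) (auto simp: cyclic_cubic_dual_pair eq)
    with inverse[OF that, of cyclic_cubic] \<open>y < n\<close> show ?thesis by simp
  qed
  then have "(\<Sum>j<n. const_poly (c x j cyclic_cubic) * mon (dual_pair (int j)))
      = (\<Sum>j<n. if x = j then const_poly (g cyclic_cubic) * mon (dual_pair (int j)) else 0)"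
    if "x < n" for x
    using that by (intro sum.cong) auto
  then have "gen q cyclic_cubic = const_poly (g cyclic_cubic) * mon q
      - (\<Sum>x<n. const_poly (lookup cyclic_cubic (q + var (int x)))
          * (const_poly (g cyclic_cubic) * mon (dual_pair (int x))))"
    unfolding gen_def by (intro arg_cong2[where f = minus] refl sum.cong) auto
  also have "\<dots> = const_poly (g cyclic_cubic) * (mon q
      - (\<Sum>x<n. const_poly (lookup cyclic_cubic (q + var (int x))) * mon (dual_pair (int x))))"
    by (simp add: right_diff_distrib sum_distrib_left mult_ac)
  finally show ?thesis .
qed

section \<open>Spanning in degrees 4 and 5 near the cyclic cubic\<close>

definition quadrics :: "((nat \<Rightarrow>\<^sub>0 nat) \<Rightarrow>\<^sub>0 'k) set"
  where "quadrics = {const_poly d * gen q cyclic_cubic | d q. q \<in> exponents_of_degree n 2}"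

definition gen_products ::
    "(nat \<Rightarrow>\<^sub>0 nat) \<times> (nat \<Rightarrow>\<^sub>0 nat) \<Rightarrow> ((nat \<Rightarrow>\<^sub>0 nat) \<Rightarrow>\<^sub>0 'k) \<Rightarrow> (nat \<Rightarrow>\<^sub>0 nat) \<Rightarrow>\<^sub>0 'k"
  where "gen_products = (\<lambda>(q, q') f. gen q f * gen q' f)"

abbreviation quadratic_pairs :: "((nat \<Rightarrow>\<^sub>0 nat) \<times> (nat \<Rightarrow>\<^sub>0 nat)) set"
  where "quadratic_pairs \<equiv> exponents_of_degree n 2 \<times> exponents_of_degree n 2"

lemma finite_quadratic_pairs: "finite quadratic_pairs"
  by (intro finite_cartesian_product finite_exponents_of_degree)

lemma gen_products_homogeneous:
  "j \<in> quadratic_pairs \<Longrightarrow> keys (gen_products j f) \<subseteq> exponents_of_degree n 4"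
  using keys_mult_exponents_of_degree[OF gen_homogeneous gen_homogeneous]
  by (fastforce simp: gen_products_def)

lemma regular_poly_gen_products: "j \<in> quadratic_pairs \<Longrightarrow> regular_poly n (gen_products j)"
  by (auto simp: gen_products_def intro!: regular_poly_mult regular_poly_gen)

lemma var_pair_degree: "var i + var j \<in> exponents_of_degree n 2"
  using exponents_of_degree_add[OF var_degree var_degree] by (simp add: numeral_2_eq_2)

text \<open>The scalars allowed in \<open>quadrics\<close> absorb the nonzero constant
  \<open>g cyclic_cubic\<close>.\<close>

lemma quadricsI:
  assumes "gen q cyclic_cubic = const_poly (g cyclic_cubic) * p" "q \<in> exponents_of_degree n 2"
  shows "p \<in> quadrics"
proof -
  have "p = const_poly (inverse (g cyclic_cubic)) * gen q cyclic_cubic"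
    unfolding assms(1) mult.assoc[symmetric] using g_cyclic_cubic
    by (simp flip: const_poly_simps)
  then show ?thesis unfolding quadrics_def using assms(2) by blast
qed

lemma far_quadric:
  assumes "d = 0 \<or> 3 \<le> d \<and> d \<le> int n - 3"
  shows "mon (var i) * mon (var (i + d)) \<in> quadrics"
proof (rule quadricsI)
  show "gen (var i + var (i + d)) cyclic_cubic
      = const_poly (g cyclic_cubic) * (mon (var i) * mon (var (i + d)))"
    by (simp add: gen_cyclic_cubic cyclic_cubic_far[OF assms] mult_single)
qed (rule var_pair_degree)

lemma sum_dual_pair:
  "(\<Sum>x<n. const_poly (if var (int x) = var i then 1 else 0) * mon (dual_pair (int x)))
    = (mon (dual_pair i) :: (nat \<Rightarrow>\<^sub>0 nat) \<Rightarrow>\<^sub>0 'k)"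
proof -
  obtain v where v: "v < n" "var i = var (int v)" by (rule var_obtain)
  have "var (int x) = var i \<longleftrightarrow> x = v" if "x < n" for x
    using var_neq[of "int x" "int v"] v that by force
  then have "(\<Sum>x<n. const_poly (if var (int x) = var i then 1 else 0) * mon (dual_pair (int x)))
      = (\<Sum>x<n. if x = v then mon (dual_pair (int v)) else 0 :: (nat \<Rightarrow>\<^sub>0 nat) \<Rightarrow>\<^sub>0 'k)"
    by (intro sum.cong) auto
  then show ?thesis using v dual_pair_cong[of i "int v"] by simp
qed

text \<open>The subtracted products are the dual pairs of \<open>i - 1\<close> and
  \<open>i + 2\<close>, the two variables that complete \<open>i\<close> and \<open>i + 1\<close> to
  an edge.\<close>

lemma adjacent_quadric:
  "mon (var i) * mon (var (i + 1)) - mon (var (i - 2)) * mon (var i)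
    - mon (var (i + 1)) * mon (var (i + 3)) \<in> quadrics"
proof (rule quadricsI)
  have "(\<Sum>x<n. const_poly (lookup cyclic_cubic (var i + var (i + 1) + var (int x)))
      * mon (dual_pair (int x))) = mon (dual_pair (i - 1)) + (mon (dual_pair (i + 2)) :: (nat \<Rightarrow>\<^sub>0 nat) \<Rightarrow>\<^sub>0 'k)"
    unfolding cyclic_cubic_adjacent const_poly_simps(3) distrib_right sum.distrib sum_dual_pair ..
  moreover have "dual_pair (i - 1) = var (i - 2) + var i" "dual_pair (i + 2) = var (i + 1) + var (i + 3)"
    by (simp_all add: dual_pair_def add.commute)
  ultimately show "gen (var i + var (i + 1)) cyclic_cubic = const_poly (g cyclic_cubic)
      * (mon (var i) * mon (var (i + 1)) - mon (var (i - 2)) * mon (var i)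
        - mon (var (i + 1)) * mon (var (i + 3)))"
    unfolding gen_cyclic_cubic by (simp only: mult_single diff_diff_eq mult_1)
qed (rule var_pair_degree)

lemma cyclic_quadrics_quadrics:
  "cyclic_quadrics (int n) (\<lambda>i. mon (var i)) quadrics
    (lin_span quadratic_pairs (\<lambda>j. gen_products j cyclic_cubic))"
proof
  fix i
  show "int n \<ge> 18" using n_ge_18 by simp
  show "mon (var (i + int n)) = mon (var i)" by (simp add: var_periodic)
  show "mon (var i) * mon (var i) \<in> quadrics" using far_quadric[of 0 i] by simp
  show "mon (var i) * mon (var (i + d)) \<in> quadrics" if "3 \<le> d" "d \<le> int n - 3" for d
    using that by (intro far_quadric) auto
  fix p q assume "p \<in> quadrics" "q \<in> quadrics"
  then obtain a b k l where "a \<in> exponents_of_degree n 2" "b \<in> exponents_of_degree n 2"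
    and pq: "p = const_poly k * gen a cyclic_cubic" "q = const_poly l * gen b cyclic_cubic"
    by (auto simp: quadrics_def)
  then have "gen_products (a, b) cyclic_cubic
      \<in> lin_span quadratic_pairs (\<lambda>j. gen_products j cyclic_cubic)"
    by (intro lin_span_base[OF finite_quadratic_pairs]) auto
  moreover have "p * q = const_poly (k * l) * gen_products (a, b) cyclic_cubic"
    by (simp add: pq gen_products_def mult_ac)
  ultimately show "p * q \<in> lin_span quadratic_pairs (\<lambda>j. gen_products j cyclic_cubic)"
    by (simp only: lin_span_const_mult)
qed (use adjacent_quadric lin_span_diff in auto)

text \<open>The products deform with \<open>f\<close> inside the squared annihilator, while the
  \<open>n\<close> class monomials stay fixed and are left to span the quotient.\<close>

definition quartic_family ::
    "(nat \<Rightarrow>\<^sub>0 nat) \<times> (nat \<Rightarrow>\<^sub>0 nat) + nat \<Rightarrow> ((nat \<Rightarrow>\<^sub>0 nat) \<Rightarrow>\<^sub>0 'k) \<Rightarrow> (nat \<Rightarrow>\<^sub>0 nat) \<Rightarrow>\<^sub>0 'k"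
  where "quartic_family = case_sum gen_products (\<lambda>j _. mon (class_monomial (int j)))"

lemma quartics_spanned:
  "\<exists>h. regular_fun n h \<and> h cyclic_cubic \<noteq> 0 \<and>
    (\<forall>f p. h f \<noteq> 0 \<longrightarrow> keys p \<subseteq> exponents_of_degree n 4 \<longrightarrow>
      p \<in> lin_span (quadratic_pairs <+> {..<n}) (\<lambda>j. quartic_family j f))"
proof (rule spanning_open)
  let ?J = "quadratic_pairs <+> {..<n}"
  let ?V = "lin_span ?J (\<lambda>j. quartic_family j cyclic_cubic)"
  show fin: "finite ?J" using finite_quadratic_pairs by simp
  show "finite (exponents_of_degree n 4)" by (rule finite_exponents_of_degree)
  show "regular_poly n (quartic_family j)" if "j \<in> ?J" for j
    using that regular_poly_gen_products by (auto simp: quartic_family_def regular_poly_const)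
  show "keys (quartic_family j f) \<subseteq> exponents_of_degree n 4" if "j \<in> ?J" for j f
  proof (cases j)
    case (Inl q)
    then have "q \<in> quadratic_pairs" using that by auto
    from gen_products_homogeneous[OF this, of f] show ?thesis by (simp add: quartic_family_def Inl)
  qed (simp add: quartic_family_def class_monomial_degree)
  interpret cyclic_quadrics "int n" "\<lambda>i. mon (var i) :: (nat \<Rightarrow>\<^sub>0 nat) \<Rightarrow>\<^sub>0 'k" quadrics
    "lin_span quadratic_pairs (\<lambda>j. gen_products j cyclic_cubic)"
    by (rule cyclic_quadrics_quadrics)
  have W_V: "lin_span quadratic_pairs (\<lambda>j. gen_products j cyclic_cubic) \<subseteq> ?V"
  proof (rule lin_span_subset)
    fix j assume "j \<in> quadratic_pairs"
    then show "gen_products j cyclic_cubic \<in> ?V"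
      using lin_span_base[OF fin, of "Inl j" "\<lambda>j. quartic_family j cyclic_cubic"]
      by (auto simp: quartic_family_def)
  qed
  have base: "edge_times i (i + 9) \<in> ?V" for i
  proof -
    obtain v where v: "v < n" "var i = var (int v)" by (rule var_obtain)
    have "class_monomial i = class_monomial (int v)"
      using v(2) edge_cong[of "i + 8" "int v + 8"] by (simp add: class_monomial_def var_eq_iff)
    \<comment> \<open>\<open>edge_times\<close> refers to the middle of an edge and
      \<open>edge\<close> to its first variable, hence 9 against 8.\<close>
    moreover have "edge_times i (i + 9) = mon (class_monomial i)"
      by (simp add: edge_times_def class_monomial_def edge_def mult_single add_ac)
    ultimately show ?thesis
      using v(1) lin_span_base[OF fin, of "Inr v" "\<lambda>j. quartic_family j cyclic_cubic"]
      by (auto simp: quartic_family_def)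
  qed
  interpret cyclic_quartics "int n" "\<lambda>i. mon (var i) :: (nat \<Rightarrow>\<^sub>0 nat) \<Rightarrow>\<^sub>0 'k" quadrics
    "lin_span quadratic_pairs (\<lambda>j. gen_products j cyclic_cubic)" ?V
  proof
    fix s i
    assume "3 \<le> s" "s \<le> int n - 3"
    from lin_span_add[OF subsetD[OF W_V edge_times_far[OF this, of i]] base[of i]]
    show "edge_times i (i + s) \<in> ?V" by simp
  qed (use W_V lin_span_diff in auto)
  fix a assume "a \<in> exponents_of_degree n 4"
  then have "a \<in> exponents_of_degree n (Suc (Suc (Suc (Suc 0))))" by (simp add: numeral_eq_Suc)
  then obtain i j k l where "a = var i + (var j + (var k + (var l + 0)))"
    by (metis var_plus_of_degree exponents_of_degree_0 singletonD)
  then have "mon a = mon (var i) * mon (var j) * mon (var k) * (mon (var l) :: (nat \<Rightarrow>\<^sub>0 nat) \<Rightarrow>\<^sub>0 'k)"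
    by (simp add: mult_single add.assoc)
  then show "mon a \<in> ?V" using quartic_in_V by simp
qed

definition quintic_family ::
    "nat \<times> (nat \<Rightarrow>\<^sub>0 nat) \<times> (nat \<Rightarrow>\<^sub>0 nat) \<Rightarrow> ((nat \<Rightarrow>\<^sub>0 nat) \<Rightarrow>\<^sub>0 'k) \<Rightarrow> (nat \<Rightarrow>\<^sub>0 nat) \<Rightarrow>\<^sub>0 'k"
  where "quintic_family = (\<lambda>(u, j) f. mon (var (int u)) * gen_products j f)"

text \<open>At \<open>cyclic_cubic\<close> this is \<open>quintic_in\<close> with \<open>W'\<close>
  the span of the family. For cubics nearby it puts all quintics into the squared
  annihilator.\<close>

lemma quintics_spanned:
  "\<exists>h. regular_fun n h \<and> h cyclic_cubic \<noteq> 0 \<and>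
    (\<forall>f p. h f \<noteq> 0 \<longrightarrow> keys p \<subseteq> exponents_of_degree n 5 \<longrightarrow>
      p \<in> lin_span ({..<n} \<times> quadratic_pairs) (\<lambda>j. quintic_family j f))"
proof (rule spanning_open)
  let ?J = "{..<n} \<times> quadratic_pairs"
  let ?V = "lin_span ?J (\<lambda>j. quintic_family j cyclic_cubic)"
  show fin: "finite ?J" by (simp add: finite_exponents_of_degree)
  show "finite (exponents_of_degree n 5)" by (rule finite_exponents_of_degree)
  show "regular_poly n (quintic_family j)" if "j \<in> ?J" for j
  proof -
    from that obtain u q where "j = (u, q)" "q \<in> quadratic_pairs" by blast
    then show ?thesis
      by (simp add: quintic_family_def regular_poly_mult regular_poly_const regular_poly_gen_products)
  qed
  show "keys (quintic_family j f) \<subseteq> exponents_of_degree n 5" if "j \<in> ?J" for j f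
  proof -
    from that obtain u q where j: "j = (u, q)" "q \<in> quadratic_pairs" by blast
    have "keys (mon (var (int u)) :: (nat \<Rightarrow>\<^sub>0 nat) \<Rightarrow>\<^sub>0 'k) \<subseteq> exponents_of_degree n 1"
      using var_degree by simp
    from keys_mult_exponents_of_degree[OF this gen_products_homogeneous[OF j(2)]]
    show ?thesis by (simp add: j(1) quintic_family_def)
  qed
  interpret cyclic_quadrics "int n" "\<lambda>i. mon (var i) :: (nat \<Rightarrow>\<^sub>0 nat) \<Rightarrow>\<^sub>0 'k" quadrics
    "lin_span quadratic_pairs (\<lambda>j. gen_products j cyclic_cubic)"
    by (rule cyclic_quadrics_quadrics)
  have W_V: "mon (var i) * w \<in> ?V"
    if "w \<in> lin_span quadratic_pairs (\<lambda>j. gen_products j cyclic_cubic)" for i w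
  proof -
    obtain v where v: "v < n" "var i = var (int v)" by (rule var_obtain)
    from that obtain d
      where "w = (\<Sum>j\<in>quadratic_pairs. const_poly (d j) * gen_products j cyclic_cubic)"
      by (auto simp: lin_span_def)
    then have "mon (var i) * w
        = (\<Sum>j\<in>quadratic_pairs. const_poly (d j) * quintic_family (v, j) cyclic_cubic)"
      by (simp add: sum_distrib_left v(2) quintic_family_def mult_ac)
    also have "\<dots> \<in> ?V"
      using v(1) lin_span_base[OF fin, where F = "\<lambda>j. quintic_family j cyclic_cubic"]
      by (intro lin_span_sum lin_span_const_mult) auto
    finally show ?thesis .
  qed
  fix a assume "a \<in> exponents_of_degree n 5"
  then have "a \<in> exponents_of_degree n (Suc (Suc (Suc (Suc (Suc 0)))))" by (simp add: numeral_eq_Suc)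
  then obtain i j k l m where "a = var i + (var j + (var k + (var l + (var m + 0))))"
    by (metis var_plus_of_degree exponents_of_degree_0 singletonD)
  then have "mon a = mon (var i)
      * (mon (var j) * mon (var k) * mon (var l) * (mon (var m) :: (nat \<Rightarrow>\<^sub>0 nat) \<Rightarrow>\<^sub>0 'k))"
    by (simp add: mult_single add.assoc)
  then show "mon a \<in> ?V" using quintic_in[of ?V, OF W_V lin_span_diff] by simp
qed

end

section \<open>Functionals dual to the class monomials\<close>

lemma pairing_partial_deriv_mon:
  "pairing f (partial_deriv v (mon a)) = of_nat (lookup a v) * lookup f (a - Poly_Mapping.single v 1)"
  by (simp add: partial_deriv_single pairing_single)

context cyclic_arrangement
begin

lemma var_of_nat_eq_iff: "u < n \<Longrightarrow> v < n \<Longrightarrow> var (int u) = var (int v) \<longleftrightarrow> u = v"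
  using var_neq[of "int u" "int v"] by force

text \<open>The monomial is squarefree, so no multiplicity can vanish in positive characteristic.
  Removing \<open>var j\<close> leaves an edge; removing a variable of the edge leaves
  \<open>var j\<close> together with a distant variable, a pair that no edge contains.\<close>

lemma pairing_partial_deriv_class_monomial:
  assumes "y < n" "j < n"
  shows "pairing cyclic_cubic (partial_deriv y (mon (class_monomial (int j))))
    = (if y = j then 1 else 0 :: 'k::field)"
proof -
  let ?j = "int j"
  let ?a = "class_monomial ?j"
  have y: "Poly_Mapping.single y 1 = var (int y)" "y = nat (int y mod int n)"
    using assms by (simp_all add: var_of_nat)
  have lookup: "lookup (var i) y = (if var i = var (int y) then 1 else 0)" for i
    using lookup_var_at[of i "int y"] y(2) by simp
  have a: "?a = var ?j + (var (?j + 8) + var (?j + 9) + var (?j + 10))"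
    by (simp add: class_monomial_def edge_def ac_simps)
  have count: "lookup ?a y = (if var ?j = var (int y) then 1 else 0)
      + ((if var (?j + 8) = var (int y) then 1 else 0)
        + (if var (?j + 9) = var (int y) then 1 else 0)
        + (if var (?j + 10) = var (int y) then 1 else 0))"
    by (simp only: a lookup_add lookup add.assoc)
  show ?thesis
  proof (cases "y = j")
    case True
    have "var (?j + d) \<noteq> var ?j" if "d \<in> {8, 9, 10}" for d
      using that n_ge_18 by (intro var_neq) auto
    with count True have "lookup ?a y = 1" by simp
    moreover have "?a - Poly_Mapping.single y 1 = edge (?j + 8)"
      using y(1) True by (simp add: class_monomial_def)
    ultimately show ?thesis using True by (simp add: pairing_partial_deriv_mon)
  next
    case False
    have "lookup cyclic_cubic (?a - Poly_Mapping.single y 1) = (0 :: 'k)" if "lookup ?a y \<noteq> 0"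
    proof -
      have far: "lookup cyclic_cubic (var ?j + var (?j + d) + var k) = (0 :: 'k)"
        if "d \<in> {8, 9}" for d k
        using that n_ge_18 by (intro cyclic_cubic_far) auto
      have "var ?j \<noteq> var (int y)" using False assms var_of_nat_eq_iff by simp
      with that count have "var (int y) = var (?j + 8) \<or> var (int y) = var (?j + 9)
        \<or> var (int y) = var (?j + 10)"
        by (simp split: if_splits)
      then have "?a = var (int y) + (var ?j + var (?j + 9) + var (?j + 10))
        \<or> ?a = var (int y) + (var ?j + var (?j + 8) + var (?j + 10))
        \<or> ?a = var (int y) + (var ?j + var (?j + 8) + var (?j + 9))"
        unfolding a by (auto simp: ac_simps)
      then show ?thesis unfolding y(1) using far[of 8] far[of 9] by auto
    qed
    then show ?thesis using False by (cases "lookup ?a y = 0") (auto simp: pairing_partial_deriv_mon)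
  qed
qed

lemma regular_fun_pairing_class_monomial:
  "regular_fun n (\<lambda>f. pairing f (partial_deriv y (mon (class_monomial j))))"
\<comment> \<open>If \<open>y\<close> does not occur, the truncated exponent keeps degree 4 and is
  no coordinate on cubics; the factor 0 settles this case.\<close>
proof (cases "lookup (class_monomial j) y = 0")
  case True
  then show ?thesis by (simp add: pairing_partial_deriv_mon regular_fun_const)
next
  case False
  let ?b = "class_monomial j - Poly_Mapping.single y 1"
  have "class_monomial j = Poly_Mapping.single y 1 + ?b"
    using False by (intro poly_mapping_eqI) (auto simp: lookup_add lookup_minus lookup_single when_def)
  then have "Poly_Mapping.single y 1 + ?b \<in> exponents_of_degree n 4"
    using class_monomial_degree[of j] by simp
  then have "?b \<in> exponents {..<n}" "exponent_degree ?b = 3"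
    by (simp_all add: exponents_of_degree_def exponents_add exponent_degree_add)
  then show ?thesis unfolding pairing_partial_deriv_mon
    by (intro regular_fun_mult regular_fun_const regular_fun_lookup)
qed

lemma identity_combination:
  assumes "x < n"
  shows "\<exists>c. \<forall>y\<in>{..<n}. (\<Sum>j<n. c j * (if j = y then 1 else 0)) = (if x = y then 1 else (0::'k::field))"
proof (intro exI[of _ "\<lambda>j. if j = x then 1 else 0"] ballI)
  fix y assume "y \<in> {..<n}"
  have "(\<Sum>j<n. (if j = x then 1 else 0) * (if j = y then 1 else 0))
      = (\<Sum>j<n. if j = x then if x = y then 1 else 0 else (0::'k))"
    by (intro sum.cong) auto
  with assms show "(\<Sum>j<n. (if j = x then 1 else 0) * (if j = y then 1 else 0))
      = (if x = y then 1 else (0::'k))" by simp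
qed

text \<open>Serves three matrices that are the identity at \<open>cyclic_cubic\<close>: that of the
  dual pairs, its transpose, and that of the derivatives of the class monomials.\<close>

lemma invertible_near_cyclic_cubic:
  fixes v :: "nat \<Rightarrow> nat \<Rightarrow> ((nat \<Rightarrow>\<^sub>0 nat) \<Rightarrow>\<^sub>0 'k::field) \<Rightarrow> 'k"
  assumes "\<And>j y. regular_fun n (v j y)"
    and "\<And>j y. j < n \<Longrightarrow> y < n \<Longrightarrow> v j y cyclic_cubic = (if j = y then 1 else 0)"
  shows "\<exists>g. regular_fun n g \<and> g cyclic_cubic \<noteq> 0 \<and> (\<forall>x<n. \<exists>c. (\<forall>j<n. regular_fun n (c j)) \<and>
    (\<forall>f. \<forall>y<n. (\<Sum>j<n. c j f * v j y f) = (if x = y then g f else 0)))"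
proof -
  have "\<exists>c. \<forall>y\<in>{..<n}. (\<Sum>j<n. c j * v j y cyclic_cubic) = (if x = y then 1 else 0)"
    if "x \<in> {..<n}" for x
    using identity_combination[of x] that assms(2) by (simp cong: sum.cong_simp)
  from regular_elimination[of "{..<n}" "{..<n}" n v cyclic_cubic, OF _ _ assms(1) this]
  show ?thesis by (simp add: Ball_def)
qed

lemma cyclic_cubic_dual_pair_nat:
  "j < n \<Longrightarrow> y < n \<Longrightarrow>
    lookup cyclic_cubic (dual_pair (int j) + var (int y)) = (if j = y then 1 else 0 :: 'k::field)"
  using var_of_nat_eq_iff[of y j] by (auto simp: cyclic_cubic_dual_pair)

lemma dual_inverse_exists:
  "\<exists>g c. dual_inverse n (g :: ((nat \<Rightarrow>\<^sub>0 nat) \<Rightarrow>\<^sub>0 'k::field) \<Rightarrow> 'k) c"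
proof -
  obtain g :: "((nat \<Rightarrow>\<^sub>0 nat) \<Rightarrow>\<^sub>0 'k) \<Rightarrow> 'k" where g: "regular_fun n g" "g cyclic_cubic \<noteq> 0"
    and ex: "\<forall>x<n. \<exists>c. (\<forall>j<n. regular_fun n (c j)) \<and>
      (\<forall>f. \<forall>y<n. (\<Sum>j<n. c j f * lookup f (dual_pair (int j) + var (int y))) = (if x = y then g f else 0))"
    using invertible_near_cyclic_cubic[where
        v = "\<lambda>j y (f :: (nat \<Rightarrow>\<^sub>0 nat) \<Rightarrow>\<^sub>0 'k). lookup f (dual_pair (int j) + var (int y))",
        OF regular_fun_dual_pair cyclic_cubic_dual_pair_nat] by blast
  have "\<forall>x\<in>{..<n}. \<exists>c. (\<forall>j<n. regular_fun n (c j)) \<and>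
      (\<forall>f. \<forall>y<n. (\<Sum>j<n. c j f * lookup f (dual_pair (int j) + var (int y))) = (if x = y then g f else 0))"
    using ex by (simp only: lessThan_iff Ball_def)
  from bchoice[OF this] obtain c where c: "\<forall>x\<in>{..<n}. (\<forall>j<n. regular_fun n (c x j)) \<and>
      (\<forall>f. \<forall>y<n. (\<Sum>j<n. c x j f * lookup f (dual_pair (int j) + var (int y))) = (if x = y then g f else 0))"
    by (rule exE)
  have "dual_inverse n g c" by unfold_locales (use g c in auto)
  then show ?thesis by blast
qed

end

section \<open>Hilbert functions of a cubic near the cyclic one\<close>

lemma ideal_sum_closed:
  assumes "ideal J (S_ring n)" "\<And>x. x \<in> A \<Longrightarrow> h x \<in> J"
  shows "(\<Sum>x\<in>A. h x) \<in> J"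
proof -
  have J: "additive_subgroup J (S_ring n)" using assms(1) by (rule ideal.axioms)
  have "p + q \<in> J" if "p \<in> J" "q \<in> J" for p q
    using additive_subgroup.a_closed[OF J that] by simp
  moreover have "0 \<in> J" using additive_subgroup.zero_closed[OF J] by simp
  ultimately show ?thesis using assms(2)
    by (induction A rule: infinite_finite_induct) simp_all
qed

lemma ideal_const_mult_closed:
  assumes "ideal J (S_ring n)" "p \<in> J"
  shows "const_poly c * p \<in> J"
  using ideal.I_l_closed[OF assms, of "const_poly c"] by (simp add: poly_ring_carrier_closed)

context dual_inverse
begin

text \<open>The coefficient at \<open>edge 0\<close> makes \<open>f\<close> nonzero and settles
  degrees 0 and 3; \<open>g f\<close> is the denominator in degrees 1 and 2.\<close>

context
  fixes f :: "(nat \<Rightarrow>\<^sub>0 nat) \<Rightarrow>\<^sub>0 'k"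
  assumes f: "f \<in> cubics n" and g_f: "g f \<noteq> 0" and edge_f: "lookup f (edge 0) \<noteq> 0"
begin

lemma pairing_Ann: "s \<in> Ann n f \<Longrightarrow> pairing f (s * t) = 0"
  by (simp add: Ann_iff)

lemma one_notin_Ann: "1 \<notin> Ann n f"
  using pairing_Ann[of 1 "mon (edge 0)"] edge_f by (auto simp: pairing_single)

lemma mon_homogeneous:
  "a \<in> exponents_of_degree n d \<Longrightarrow> (mon a :: (nat \<Rightarrow>\<^sub>0 nat) \<Rightarrow>\<^sub>0 'k) \<in> carrier (S_ring n)"
  "a \<in> exponents_of_degree n d \<Longrightarrow> homogeneous_of_degree d (mon a :: (nat \<Rightarrow>\<^sub>0 nat) \<Rightarrow>\<^sub>0 'k)"
  using keys_subset_exponents_of_degree[of "mon a :: (nat \<Rightarrow>\<^sub>0 nat) \<Rightarrow>\<^sub>0 'k" n d] by simp_all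

lemma hilbert_Ann_0: "hilbert_function n (Ann n f) 0 = 1"
proof (rule hilbert_function_eqI[where m = "\<lambda>_. 1"])
  fix p :: "(nat \<Rightarrow>\<^sub>0 nat) \<Rightarrow>\<^sub>0 'k"
  assume "p \<in> carrier (S_ring n)" "homogeneous_of_degree 0 p"
  then have "keys p \<subseteq> {0}"
    using keys_subset_exponents_of_degree[of p n 0] by (simp add: exponents_of_degree_0)
  from sum_monomials[OF _ this] have "p = const_poly (lookup p 0)" by simp
  then show "\<exists>c. p - (\<Sum>j<1::nat. const_poly (c j) * 1) \<in> Ann n f"
    using Ann_closed(4) by (intro exI[of _ "\<lambda>_. lookup p 0"]) simp
next
  fix c :: "nat \<Rightarrow> 'k" and j :: nat
  assume "(\<Sum>j<1::nat. const_poly (c j) * 1) \<in> Ann n f" "j < 1"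
  then show "c j = 0"
    using pairing_Ann[of "const_poly (c 0)" "mon (edge 0)"] edge_f
    by (simp add: pairing_const_mult pairing_single)
qed (use one_notin_Ann in \<open>simp_all add: ideal_Ann poly_ring_carrier_closed homogeneous_of_degree_def
  exponent_degree_def\<close>)

lemma hilbert_Ann_1: "hilbert_function n (Ann n f) 1 = n"
proof (rule hilbert_function_eqI[where m = "\<lambda>j. mon (var (int j))"])
  fix p :: "(nat \<Rightarrow>\<^sub>0 nat) \<Rightarrow>\<^sub>0 'k"
  assume p: "p \<in> carrier (S_ring n)" "homogeneous_of_degree 1 p"
  have "p \<in> lin_span {..<n} (\<lambda>j. mon (var (int j)))"
  proof (rule in_lin_span_monomials[OF finite_exponents_of_degree])
    show "keys p \<subseteq> exponents_of_degree n 1" using p by (simp add: keys_subset_exponents_of_degree)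
    fix a assume "a \<in> exponents_of_degree n 1"
    then obtain v where "v < n" "a = var (int v)" by (rule var_of_degree_1)
    then show "mon a \<in> lin_span {..<n} (\<lambda>j. mon (var (int j)))"
      using lin_span_base[of "{..<n}" v "\<lambda>j. mon (var (int j))"] by simp
  qed
  then obtain c where "p = (\<Sum>j<n. const_poly (c j) * mon (var (int j)))"
    by (auto simp: lin_span_def)
  then show "\<exists>c. p - (\<Sum>j<n. const_poly (c j) * mon (var (int j))) \<in> Ann n f"
    using Ann_closed(4) by (intro exI[of _ c]) simp
next
  fix c' :: "nat \<Rightarrow> 'k" and x
  assume *: "(\<Sum>j<n. const_poly (c' j) * mon (var (int j))) \<in> Ann n f" and x: "x < n"
  have zero: "(\<Sum>y<n. c' y * lookup f (dual_pair (int j) + var (int y))) = 0" for j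
    using pairing_Ann[OF *, of "mon (dual_pair (int j))"] by (simp add: pairing_linear add.commute)
  have "g f * c' x = (\<Sum>y<n. c' y * (if x = y then g f else 0))"
    using x by (simp add: if_distrib cong: if_cong)
  also have "\<dots> = (\<Sum>y<n. c' y * (\<Sum>j<n. c x j f * lookup f (dual_pair (int j) + var (int y))))"
    using x by (intro sum.cong) (simp_all add: inverse)
  also have "\<dots> = (\<Sum>j<n. c x j f * (\<Sum>y<n. c' y * lookup f (dual_pair (int j) + var (int y))))"
    unfolding sum_distrib_left by (subst sum.swap) (simp add: mult_ac)
  finally show "c' x = 0" using zero g_f by simp
qed (use one_notin_Ann mon_homogeneous[OF var_degree] in \<open>simp_all add: ideal_Ann\<close>)

text \<open>Spanning uses the inverse \<open>c\<close> of the locale, independence the inverse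
  \<open>d\<close> on the other side, which a separate elimination on the transpose
  supplies.\<close>

lemma hilbert_Ann_2:
  assumes h: "h \<noteq> 0" and d: "\<And>x. x < n \<Longrightarrow> \<exists>d. \<forall>j<n.
    (\<Sum>y<n. d y * lookup f (dual_pair (int j) + var (int y))) = (if x = j then h else 0)"
  shows "hilbert_function n (Ann n f) 2 = n"
proof (rule hilbert_function_eqI[where m = "\<lambda>j. mon (dual_pair (int j))"])
  fix p :: "(nat \<Rightarrow>\<^sub>0 nat) \<Rightarrow>\<^sub>0 'k"
  assume p: "p \<in> carrier (S_ring n)" "homogeneous_of_degree 2 p"
  \<comment> \<open>Chosen so that the combination of dual pairs contracts \<open>f\<close> in the
    same way as \<open>p\<close>.\<close>
  define e where "e j = (\<Sum>x<n. pairing f (p * mon (var (int x))) * c x j f) / g f" for j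
  define r where "r = p - (\<Sum>j<n. const_poly (e j) * mon (dual_pair (int j)))"
  have "keys (\<Sum>j<n. const_poly (e j) * mon (dual_pair (int j))) \<subseteq> exponents_of_degree n 2"
    using keys_sum keys_const_mult_subset dual_pair_degree by fastforce
  then have "keys r \<subseteq> exponents_of_degree n 2"
    using keys_diff[of p] p keys_subset_exponents_of_degree[of p n 2] unfolding r_def by blast
  then have r: "r \<in> carrier (S_ring n)" "homogeneous_of_degree 2 r"
    by (simp_all add: keys_subset_exponents_of_degree)
  have "r \<in> Ann n f"
  proof (rule Ann_homogeneousI[OF f r])
    fix a assume "a \<in> exponents {..<n}" "2 + exponent_degree a = 3"
    then have "a \<in> exponents_of_degree n 1" by (simp add: exponents_of_degree_def)
    then obtain y where y: "y < n" "a = var (int y)" by (rule var_of_degree_1)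
    have "(\<Sum>j<n. e j * lookup f (dual_pair (int j) + var (int y)))
        = (\<Sum>j<n. \<Sum>x<n. pairing f (p * mon (var (int x)))
            * (c x j f * lookup f (dual_pair (int j) + var (int y)))) / g f"
      by (simp add: e_def sum_distrib_right sum_divide_distrib mult.assoc)
    also have "\<dots> = (\<Sum>x<n. pairing f (p * mon (var (int x)))
            * (\<Sum>j<n. c x j f * lookup f (dual_pair (int j) + var (int y)))) / g f"
      by (subst sum.swap) (simp add: sum_distrib_left)
    also have "\<dots> = (\<Sum>x<n. pairing f (p * mon (var (int x))) * (if x = y then g f else 0)) / g f"
      using y(1) by (simp add: inverse cong: sum.cong_simp)
    also have "\<dots> = pairing f (p * mon a)"
      using y g_f by (simp add: if_distrib cong: if_cong)
    finally show "pairing f (r * mon a) = 0" unfolding r_def pairing_linear y(2) by simp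
  qed
  then show "\<exists>c. p - (\<Sum>j<n. const_poly (c j) * mon (dual_pair (int j))) \<in> Ann n f"
    unfolding r_def by blast
next
  fix c' :: "nat \<Rightarrow> 'k" and x
  assume *: "(\<Sum>j<n. const_poly (c' j) * mon (dual_pair (int j))) \<in> Ann n f" and x: "x < n"
  have zero: "(\<Sum>j<n. c' j * lookup f (dual_pair (int j) + var (int y))) = 0" for y
    using pairing_Ann[OF *, of "mon (var (int y))"] by (simp add: pairing_linear)
  obtain d where d: "\<And>j. j < n \<Longrightarrow>
      (\<Sum>y<n. d y * lookup f (dual_pair (int j) + var (int y))) = (if x = j then h else 0)"
    using d[OF x] by blast
  have "h * c' x = (\<Sum>j<n. c' j * (if x = j then h else 0))"
    using x by (simp add: if_distrib cong: if_cong)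
  also have "\<dots> = (\<Sum>j<n. c' j * (\<Sum>y<n. d y * lookup f (dual_pair (int j) + var (int y))))"
    by (intro sum.cong) (simp_all add: d)
  also have "\<dots> = (\<Sum>y<n. d y * (\<Sum>j<n. c' j * lookup f (dual_pair (int j) + var (int y))))"
    unfolding sum_distrib_left by (subst sum.swap) (simp add: mult_ac)
  finally show "c' x = 0" using zero h by simp
qed (use one_notin_Ann mon_homogeneous[OF dual_pair_degree] in \<open>simp_all add: ideal_Ann\<close>)

lemma hilbert_Ann_3: "hilbert_function n (Ann n f) 3 = 1"
proof (rule hilbert_function_eqI[where m = "\<lambda>_. mon (edge 0)"])
  fix p :: "(nat \<Rightarrow>\<^sub>0 nat) \<Rightarrow>\<^sub>0 'k"
  assume p: "p \<in> carrier (S_ring n)" "homogeneous_of_degree 3 p"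
  define r where "r = p - const_poly (pairing f p / lookup f (edge 0)) * mon (edge 0)"
  have "keys (const_poly (pairing f p / lookup f (edge 0)) * mon (edge 0)) \<subseteq> exponents_of_degree n 3"
    using keys_const_mult_subset edge_degree by fastforce
  then have "keys r \<subseteq> exponents_of_degree n 3"
    using keys_diff[of p] p keys_subset_exponents_of_degree[of p n 3] unfolding r_def by blast
  then have r: "r \<in> carrier (S_ring n)" "homogeneous_of_degree 3 r"
    by (simp_all add: keys_subset_exponents_of_degree)
  have "r \<in> Ann n f"
  proof (rule Ann_homogeneousI[OF f r])
    fix a assume "a \<in> exponents {..<n}" "3 + exponent_degree a = 3"
    then have "a \<in> exponents_of_degree n 0" by (simp add: exponents_of_degree_def)
    then have "a = 0" by (simp add: exponents_of_degree_0)
    then show "pairing f (r * mon a) = 0"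
      using edge_f by (simp add: r_def pairing_diff pairing_const_mult pairing_single)
  qed
  then show "\<exists>c. p - (\<Sum>j<1::nat. const_poly (c j) * mon (edge 0)) \<in> Ann n f"
    unfolding r_def by (intro exI[of _ "\<lambda>_. pairing f p / lookup f (edge 0)"]) simp
next
  fix c :: "nat \<Rightarrow> 'k" and j :: nat
  assume "(\<Sum>j<1::nat. const_poly (c j) * mon (edge 0)) \<in> Ann n f" "j < 1"
  then show "c j = 0"
    using pairing_Ann[of "const_poly (c 0) * mon (edge 0)" 1] edge_f
    by (simp add: pairing_const_mult pairing_single)
qed (use one_notin_Ann mon_homogeneous[OF edge_degree] in \<open>simp_all add: ideal_Ann\<close>)

lemma hilbert_Ann_ge_4:
  assumes "i \<ge> 4"
  shows "hilbert_function n (Ann n f) i = 0"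
proof (rule hilbert_function_eqI[where m = "\<lambda>_. 0"])
  fix p :: "(nat \<Rightarrow>\<^sub>0 nat) \<Rightarrow>\<^sub>0 'k"
  assume "p \<in> carrier (S_ring n)" "homogeneous_of_degree i p"
  then have "p \<in> Ann n f" using assms by (intro Ann_homogeneousI[OF f]) auto
  then show "\<exists>c. p - (\<Sum>j<0::nat. const_poly (c j) * 0) \<in> Ann n f" by simp
qed (use one_notin_Ann in \<open>simp_all add: ideal_Ann\<close>)

lemma one_notin_Ann_square: "1 \<notin> Ann n f \<cdot>\<^bsub>S_ring n\<^esub> Ann n f"
  using one_notin_Ann Ann_square_subset by blast

lemma gen_products_in_Ann_square:
  assumes "j \<in> quadratic_pairs"
  shows "gen_products j f \<in> Ann n f \<cdot>\<^bsub>S_ring n\<^esub> Ann n f"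
proof -
  obtain q q' where j: "j = (q, q')" "q \<in> exponents_of_degree n 2" "q' \<in> exponents_of_degree n 2"
    using assms by blast
  show ?thesis
    using ideal_prod.prod[OF gen_in_Ann[OF f j(2)] gen_in_Ann[OF f j(3)], of "S_ring n"]
    by (simp add: j(1) gen_products_def)
qed

text \<open>\<open>d\<close> inverts the matrix of derivatives of the class monomials, so a
  combination on which all derivative functionals vanish has zero coefficients.\<close>

lemma hilbert_Ann_square_4:
  assumes h: "h \<noteq> 0" and d: "\<And>x. x < n \<Longrightarrow> \<exists>d. \<forall>j<n.
      (\<Sum>y<n. d y * pairing f (partial_deriv y (mon (class_monomial (int j))))) = (if x = j then h else 0)"
    and span: "\<And>p. keys p \<subseteq> exponents_of_degree n 4 \<Longrightarrow>
      p \<in> lin_span (quadratic_pairs <+> {..<n}) (\<lambda>j. quartic_family j f)"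
  shows "hilbert_function n (Ann n f \<cdot>\<^bsub>S_ring n\<^esub> Ann n f) 4 = n"
proof (rule hilbert_function_eqI[where m = "\<lambda>j. mon (class_monomial (int j))"])
  fix p :: "(nat \<Rightarrow>\<^sub>0 nat) \<Rightarrow>\<^sub>0 'k"
  assume "p \<in> carrier (S_ring n)" "homogeneous_of_degree 4 p"
  then have "keys p \<subseteq> exponents_of_degree n 4" by (simp add: keys_subset_exponents_of_degree)
  from span[OF this] obtain e
    where "p = (\<Sum>j\<in>quadratic_pairs <+> {..<n}. const_poly (e j) * quartic_family j f)"
    by (auto simp: lin_span_def)
  also have "\<dots> = (\<Sum>j\<in>quadratic_pairs. const_poly (e (Inl j)) * gen_products j f)
      + (\<Sum>j<n. const_poly (e (Inr j)) * mon (class_monomial (int j)))"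
    by (simp add: sum.Plus[OF finite_quadratic_pairs] quartic_family_def)
  finally have "p - (\<Sum>j<n. const_poly (e (Inr j)) * mon (class_monomial (int j)))
      = (\<Sum>j\<in>quadratic_pairs. const_poly (e (Inl j)) * gen_products j f)" by simp
  also have "\<dots> \<in> Ann n f \<cdot>\<^bsub>S_ring n\<^esub> Ann n f"
    using gen_products_in_Ann_square
    by (intro ideal_sum_closed[OF ideal_Ann_square] ideal_const_mult_closed[OF ideal_Ann_square])
  finally show "\<exists>c. p - (\<Sum>j<n. const_poly (c j) * mon (class_monomial (int j)))
      \<in> Ann n f \<cdot>\<^bsub>S_ring n\<^esub> Ann n f"
    by (intro exI[of _ "\<lambda>j. e (Inr j)"])
next
  fix c' :: "nat \<Rightarrow> 'k" and x
  assume *: "(\<Sum>j<n. const_poly (c' j) * mon (class_monomial (int j)))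
    \<in> Ann n f \<cdot>\<^bsub>S_ring n\<^esub> Ann n f" and x: "x < n"
  have zero: "(\<Sum>j<n. c' j * pairing f (partial_deriv y (mon (class_monomial (int j))))) = 0" for y
    using pairing_partial_deriv_Ann_square[OF *, of y]
    by (simp add: partial_deriv_sum partial_deriv_mult pairing_sum pairing_const_mult)
  obtain d where d: "\<And>j. j < n \<Longrightarrow> (\<Sum>y<n. d y * pairing f (partial_deriv y
      (mon (class_monomial (int j))))) = (if x = j then h else 0)"
    using d[OF x] by blast
  have "h * c' x = (\<Sum>j<n. c' j * (if x = j then h else 0))"
    using x by (simp add: if_distrib cong: if_cong)
  also have "\<dots> = (\<Sum>j<n. c' j * (\<Sum>y<n. d y * pairing f (partial_deriv y
      (mon (class_monomial (int j))))))"
    by (intro sum.cong) (simp_all add: d)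
  also have "\<dots> = (\<Sum>y<n. d y * (\<Sum>j<n. c' j * pairing f (partial_deriv y
      (mon (class_monomial (int j))))))"
    unfolding sum_distrib_left by (subst sum.swap) (simp add: mult_ac)
  finally show "c' x = 0" using zero h by simp
qed (use one_notin_Ann_square mon_homogeneous[OF class_monomial_degree] in
  \<open>simp_all add: ideal_Ann_square\<close>)

lemma hilbert_Ann_square_5:
  assumes span: "\<And>p. keys p \<subseteq> exponents_of_degree n 5 \<Longrightarrow>
    p \<in> lin_span ({..<n} \<times> quadratic_pairs) (\<lambda>j. quintic_family j f)"
  shows "hilbert_function n (Ann n f \<cdot>\<^bsub>S_ring n\<^esub> Ann n f) 5 = 0"
proof (rule hilbert_function_eqI[where m = "\<lambda>_. 0"])
  fix p :: "(nat \<Rightarrow>\<^sub>0 nat) \<Rightarrow>\<^sub>0 'k"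
  assume "p \<in> carrier (S_ring n)" "homogeneous_of_degree 5 p"
  then have "keys p \<subseteq> exponents_of_degree n 5" by (simp add: keys_subset_exponents_of_degree)
  from span[OF this] obtain e
    where "p = (\<Sum>j\<in>{..<n} \<times> quadratic_pairs. const_poly (e j) * quintic_family j f)"
    by (auto simp: lin_span_def)
  also have "\<dots> \<in> Ann n f \<cdot>\<^bsub>S_ring n\<^esub> Ann n f"
  proof (intro ideal_sum_closed[OF ideal_Ann_square] ideal_const_mult_closed[OF ideal_Ann_square])
    fix j assume "j \<in> {..<n} \<times> quadratic_pairs"
    then obtain u q where j: "j = (u, q)" "q \<in> quadratic_pairs" by blast
    show "quintic_family j f \<in> Ann n f \<cdot>\<^bsub>S_ring n\<^esub> Ann n f"
      using ideal.I_l_closed[OF ideal_Ann_square gen_products_in_Ann_square[OF j(2)]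
          mon_homogeneous(1)[OF var_degree]]
      by (simp add: j(1) quintic_family_def)
  qed
  finally show "\<exists>c. p - (\<Sum>j<0::nat. const_poly (c j) * 0) \<in> Ann n f \<cdot>\<^bsub>S_ring n\<^esub> Ann n f" by simp
qed (use one_notin_Ann_square in \<open>simp_all add: ideal_Ann_square\<close>)

lemma has_hilbert_function_Ann:
  assumes "h \<noteq> 0" "\<And>x. x < n \<Longrightarrow> \<exists>d. \<forall>j<n.
    (\<Sum>y<n. d y * lookup f (dual_pair (int j) + var (int y))) = (if x = j then h else 0)"
  shows "has_hilbert_function n (Ann n f) [1, n, n, 1]"
  unfolding has_hilbert_function_def
proof
  fix i :: nat
  consider "i = 0" | "i = 1" | "i = 2" | "i = 3" | "i \<ge> 4" by linarith
  then show "hilbert_function n (Ann n f) i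
      = (if i < length [1, n, n, 1] then [1, n, n, 1] ! i else 0)"
    by cases (use hilbert_Ann_0 hilbert_Ann_1 hilbert_Ann_2[OF assms] hilbert_Ann_3 hilbert_Ann_ge_4
      in \<open>simp_all add: numeral_2_eq_2 numeral_3_eq_3\<close>)
qed

end

end

theorem theorem3p1:
  fixes n :: nat
  assumes "n \<ge> 18"
  shows "for_general_cubic n (\<lambda>f :: (nat \<Rightarrow>\<^sub>0 nat) \<Rightarrow>\<^sub>0 'k::field. small_tangent_space_condition n f)"
proof -
  interpret cyclic_arrangement n by unfold_locales (rule assms)
  obtain g :: "((nat \<Rightarrow>\<^sub>0 nat) \<Rightarrow>\<^sub>0 'k) \<Rightarrow> 'k" and c where "dual_inverse n g c"
    using dual_inverse_exists by blast
  then interpret dual_inverse n g c .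
  let ?f\<^sub>0 = "cyclic_cubic :: (nat \<Rightarrow>\<^sub>0 nat) \<Rightarrow>\<^sub>0 'k"
  \<comment> \<open>The transposed matrix, for the independence of the dual pairs; \<open>g\<close>
    and \<open>c\<close> give their spanning.\<close>
  obtain h\<^sub>1 where h1: "regular_fun n h\<^sub>1" "h\<^sub>1 ?f\<^sub>0 \<noteq> 0"
    and h1_dual: "\<forall>x<n. \<exists>d. (\<forall>y<n. regular_fun n (d y)) \<and> (\<forall>f. \<forall>j<n.
      (\<Sum>y<n. d y f * lookup f (dual_pair (int j) + var (int y))) = (if x = j then h\<^sub>1 f else 0))"
    using invertible_near_cyclic_cubic[where
        v = "\<lambda>y j (f :: (nat \<Rightarrow>\<^sub>0 nat) \<Rightarrow>\<^sub>0 'k). lookup f (dual_pair (int j) + var (int y))",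
        OF regular_fun_dual_pair] cyclic_cubic_dual_pair_nat by fastforce
  obtain h\<^sub>2 where h2: "regular_fun n h\<^sub>2" "h\<^sub>2 ?f\<^sub>0 \<noteq> 0"
    and h2_dual: "\<forall>x<n. \<exists>d. (\<forall>y<n. regular_fun n (d y)) \<and> (\<forall>f. \<forall>j<n.
      (\<Sum>y<n. d y f * pairing f (partial_deriv y (mon (class_monomial (int j)))))
        = (if x = j then h\<^sub>2 f else 0))"
    using invertible_near_cyclic_cubic[where v = "\<lambda>y j (f :: (nat \<Rightarrow>\<^sub>0 nat) \<Rightarrow>\<^sub>0 'k).
          pairing f (partial_deriv y (mon (class_monomial (int j))))",
        OF regular_fun_pairing_class_monomial pairing_partial_deriv_class_monomial] by blast
  obtain h\<^sub>3 where h3: "regular_fun n h\<^sub>3" "h\<^sub>3 ?f\<^sub>0 \<noteq> 0"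
    and h3_span: "\<And>f p. h\<^sub>3 f \<noteq> 0 \<Longrightarrow> keys p \<subseteq> exponents_of_degree n 4 \<Longrightarrow>
      p \<in> lin_span (quadratic_pairs <+> {..<n}) (\<lambda>j. quartic_family j f)"
    using quartics_spanned by blast
  obtain h\<^sub>4 where h4: "regular_fun n h\<^sub>4" "h\<^sub>4 ?f\<^sub>0 \<noteq> 0"
    and h4_span: "\<And>f p. h\<^sub>4 f \<noteq> 0 \<Longrightarrow> keys p \<subseteq> exponents_of_degree n 5 \<Longrightarrow>
      p \<in> lin_span ({..<n} \<times> quadratic_pairs) (\<lambda>j. quintic_family j f)"
    using quintics_spanned by blast
  \<comment> \<open>The product of all denominators: where it does not vanish, every spanning and
    duality condition holds at once.\<close>
  define G where "G f = g f * h\<^sub>1 f * h\<^sub>2 f * h\<^sub>3 f * h\<^sub>4 f * lookup f (edge 0)" for f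
  show ?thesis
  proof (rule for_general_cubicI)
    have "regular_fun n (\<lambda>f :: (nat \<Rightarrow>\<^sub>0 nat) \<Rightarrow>\<^sub>0 'k. lookup f (edge 0))"
      using edge_degree[of 0] by (intro regular_fun_lookup) (simp_all add: exponents_of_degree_def)
    then show "regular_fun n G" unfolding G_def
      by (intro regular_fun_mult g_regular h1(1) h2(1) h3(1) h4(1))
    show "G ?f\<^sub>0 \<noteq> 0" using g_cyclic_cubic h1 h2 h3 h4 by (simp add: G_def)
    fix f :: "(nat \<Rightarrow>\<^sub>0 nat) \<Rightarrow>\<^sub>0 'k"
    assume f: "f \<in> cubics n" and "G f \<noteq> 0"
    then have nz: "g f \<noteq> 0" "lookup f (edge 0) \<noteq> 0" "h\<^sub>1 f \<noteq> 0" "h\<^sub>2 f \<noteq> 0" "h\<^sub>3 f \<noteq> 0" "h\<^sub>4 f \<noteq> 0"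
      by (simp_all add: G_def)
    have "\<exists>d. \<forall>j<n. (\<Sum>y<n. d y * lookup f (dual_pair (int j) + var (int y)))
        = (if x = j then h\<^sub>1 f else 0)" if "x < n" for x
    proof -
      from that h1_dual obtain d where "\<forall>f. \<forall>j<n.
          (\<Sum>y<n. d y f * lookup f (dual_pair (int j) + var (int y))) = (if x = j then h\<^sub>1 f else 0)"
        by blast
      then show ?thesis by (intro exI[of _ "\<lambda>y. d y f"]) blast
    qed
    from has_hilbert_function_Ann[OF f nz(1-3) this]
    have "has_hilbert_function n (Ann n f) [1, n, n, 1]" .
    moreover have "\<exists>d. \<forall>j<n. (\<Sum>y<n. d y * pairing f (partial_deriv y
        (mon (class_monomial (int j))))) = (if x = j then h\<^sub>2 f else 0)" if "x < n" for x
    proof -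
      from that h2_dual obtain d where "\<forall>f. \<forall>j<n. (\<Sum>y<n. d y f * pairing f (partial_deriv y
          (mon (class_monomial (int j))))) = (if x = j then h\<^sub>2 f else 0)"
        by blast
      then show ?thesis by (intro exI[of _ "\<lambda>y. d y f"]) blast
    qed
    from hilbert_Ann_square_4[OF f nz(1,2,4) this h3_span[OF nz(5)]]
    have "hilbert_function n (Ann n f \<cdot>\<^bsub>S_ring n\<^esub> Ann n f) 4 = n" .
    moreover from hilbert_Ann_square_5[OF f nz(1,2) h4_span[OF nz(6)]]
    have "hilbert_function n (Ann n f \<cdot>\<^bsub>S_ring n\<^esub> Ann n f) 5 = 0" .
    ultimately show "small_tangent_space_condition n f"
      unfolding small_tangent_space_condition_def by blast
  qed
qed

end
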